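(* There exists an integer $n_0$ such that for every integer $n\ge n_0$, $$f(n,5)=2n-2.$$
   Context: All graphs are finite and simple. For a graph $G$ on vertex set $V$ and a permutation $\pi$ of $V$, let $G_\pi$ be the graph on the same vertex set $V$ with edge set $E(G_\pi)=\{\pi(x)\pi(y): xy\in E(G)\}$. Define $I_G(\pi)=|E(G)\cap E(G_\pi)|$ and $\mu(G)=\min_\pi I_G(\pi)$, where the minimum is over all permutations $\pi$ of $V$. For an integer $k\ge 1$, define $$f(n,k)=\min\{|E(G)| : |V(G)|=n,\ \mu(G)\ge k\}.$$ *)

theory Defs
  imports Main "HOL-Combinatorics.Permutations"
begin

definition simple_graph :: "'a set \<Rightarrow> 'a set set \<Rightarrow> bool" where
  "simple_graph V E \<longleftrightarrow> finite V \<and> (\<forall>e\<in>E. e \<subseteq> V \<and> card e = 2)"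

definition permuted_edges :: "('a \<Rightarrow> 'a) \<Rightarrow> 'a set set \<Rightarrow> 'a set set" where
  "permuted_edges \<pi> E = {{\<pi> x, \<pi> y} | x y. {x, y} \<in> E}"

definition edge_intersection :: "'a set set \<Rightarrow> ('a \<Rightarrow> 'a) \<Rightarrow> nat" where
  "edge_intersection E \<pi> = card (E \<inter> permuted_edges \<pi> E)"

definition min_intersection :: "'a set \<Rightarrow> 'a set set \<Rightarrow> nat" where
  "min_intersection V E = Min {edge_intersection E \<pi> | \<pi>. \<pi> permutes V}"

text \<open>
  Since \<^term>\<open>min_intersection\<close> is invariant under isomorphism, it suffices to let the vertex sets
  range over the sets of natural numbers of size \<open>n\<close>. On \<^typ>\<open>nat\<close>, \<^term>\<open>Inf\<close> of a nonempty set is its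
  minimum and \<open>Inf {} = 0\<close>; so a positive value of \<open>min_edges n k\<close> is always attained by some graph.
\<close>
definition min_edges :: "nat \<Rightarrow> nat \<Rightarrow> nat" where
  "min_edges n k = Inf {card E | (V :: nat set) E.
     simple_graph V E \<and> card V = n \<and> min_intersection V E \<ge> k}"

end

theory Submission
  imports Defs Complex_Main
begin

text \<open>
  The wheel shows that \<open>2n - 2\<close> edges suffice. If \<open>\<pi>\<close> moves the hub \<open>u\<close>, then each of the three
  edges at \<open>\<pi>\<inverse> u\<close> is moved onto an edge at \<open>u\<close>, and each of the three edges at \<open>\<pi> u\<close> is the image
  of an edge at \<open>u\<close>; only the edge between \<open>u\<close> and \<open>\<pi> u\<close> is counted twice
  (\<open>hub_forces_five_shared_edges\<close>).

  For the lower bound, every graph with at most \<open>2n - 3\<close> edges has a permutation with at most four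
  shared edges. Let \<open>S\<close> be a set of boundedly many vertices that contains all vertices of linear
  degree. Choose \<open>\<pi>\<close> at random among the permutations that map no vertex of \<open>S\<close> into \<open>S\<close>. A shared
  edge is of one of two kinds. It is \<open>rigid\<close> if each end is in \<open>S\<close> or is mapped into \<open>S\<close>.
  Let \<open>A\<close> be the number of pairs of a vertex of \<open>S\<close> and an edge at it; then the expected number of
  rigid shared edges is about \<open>(A / n)\<^sup>2\<close>: the essential case is an edge from \<open>s \<in> S\<close> to a vertex \<open>w\<close>
  with \<open>\<pi> w = s' \<in> S\<close>, where \<open>w\<close> is a random vertex and thus adjacent to \<open>s\<close> with probability
  \<open>deg s / n\<close>, and \<open>\<pi> s\<close> is adjacent to \<open>s'\<close> with probability \<open>deg s' / n\<close>. Almost every edge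
  contributes at most once to \<open>A\<close>, so \<open>A\<close> is at most about \<open>2n\<close> and the expectation is at most about
  four. All other shared edges are \<open>loose\<close>: one end \<open>a\<close> is outside \<open>S\<close>, and so is its image. There are
  boundedly many of them on average, and they can be repaired: exchange the images of \<open>a\<close> and of a
  suitable vertex \<open>c\<close>. The number of unsuitable \<open>c\<close> is bounded by the degrees of images of neighbours
  of \<open>a\<close> and of preimages of neighbours of \<open>\<pi> a\<close>, which add up to a small fraction of \<open>n\<close> unless the
  other end of the shared edge is in \<open>S\<close> or is mapped into \<open>S\<close>; even then a suitable \<open>c\<close> exists as
  long as no vertex is adjacent to nearly all others. This is the lemma \<open>packing\<close>.

  A vertex \<open>u\<close> that is adjacent to nearly all others is treated by hand. If there are two such
  vertices, then they exchange their places with two vertices that have no other neighbours; this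
  costs four edges, and the remaining graph is so sparse that \<open>packing\<close> lets it share none. If there is
  only one, let \<open>H\<close> be the graph without \<open>u\<close>. When \<open>u\<close> exchanges its place with \<open>w\<close>, the cost is
  one (for the edge between them) plus twice the degree of \<open>w\<close> in \<open>H\<close>. If that degree is at most one,
  the cost is at most three, and \<open>packing\<close> makes the rest share at most one. Otherwise all degrees in
  \<open>H\<close> are at least two, and the bound on the number of edges forces them to be almost all equal to
  two, so that the rest can be made to share nothing. The bound also forces a vertex \<open>z\<close> that is not
  adjacent to \<open>u\<close> and has degree two or three. In the first case the exchange with \<open>w = z\<close> does
  not pay for the edge between \<open>u\<close> and \<open>w\<close>, and the cost is four. In the second case \<open>z\<close> exchanges
  its place with a neighbour \<open>y\<close> of \<open>w\<close>, which makes the edges from \<open>w\<close> to \<open>y\<close> harmless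
  (\<open>arcs_one_hub\<close>).

  Throughout, an edge is represented by its two arcs. The arithmetic is done with explicit constants:
  linear degree means more than \<open>n / 2000000\<close>, nearly all others means more than \<open>19 n / 20\<close>, and \<open>n\<close>
  is at least \<open>10 ^ 20 + 4\<close>.
\<close>

section \<open>Random permutations that move a set off itself\<close>

definition avoiding :: "'a set \<Rightarrow> 'a set \<Rightarrow> ('a \<Rightarrow> 'a) set" where
  "avoiding V S = {\<pi>. \<pi> permutes V \<and> (\<forall>s\<in>S. \<pi> s \<notin> S)}"

definition extending :: "'a set \<Rightarrow> 'a set \<Rightarrow> ('a \<times> 'a) set \<Rightarrow> ('a \<Rightarrow> 'a) set" where
  "extending V S C = {\<pi> \<in> avoiding V S. \<forall>(a, p)\<in>C. \<pi> a = p}"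

lemma finite_avoiding: "finite V \<Longrightarrow> finite (avoiding V S)"
  unfolding avoiding_def by (rule finite_subset[OF _ finite_permutations]) auto

lemma finite_extending: "finite V \<Longrightarrow> finite (extending V S C)"
  unfolding extending_def by (simp add: finite_avoiding)

lemma card_le_by_disjoint_copies:
  assumes "finite Q" "finite I" "\<And>c. c \<in> I \<Longrightarrow> A c \<subseteq> Q"
    and "\<And>c c'. c \<in> I \<Longrightarrow> c' \<in> I \<Longrightarrow> c \<noteq> c' \<Longrightarrow> A c \<inter> A c' = {}"
    and "\<And>c. c \<in> I \<Longrightarrow> card B \<le> card (A c)"
  shows "card B * card I \<le> card Q"
proof -
  have "card B * card I = (\<Sum>c\<in>I. card B)" by simp
  also have "\<dots> \<le> (\<Sum>c\<in>I. card (A c))" using assms(5) by (rule sum_mono)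
  also have "\<dots> = card (\<Union>c\<in>I. A c)"
    using assms(1-4) by (intro card_UN_disjoint[symmetric]) (auto intro: finite_subset)
  also have "\<dots> \<le> card Q" using assms(1,3) by (intro card_mono) auto
  finally show ?thesis .
qed

text \<open>
  No permutation is counted if both \<open>a\<close> and \<open>p\<close> are in \<open>S\<close>. If \<open>a\<close> is not, then \<open>\<pi> \<mapsto> \<pi> \<circ> transpose a c\<close> moves the
  requirement \<open>\<pi> a = p\<close> to any other \<open>c\<close> outside \<open>S\<close> that is free in \<open>C\<close>; if \<open>p\<close> is not, then values
  are transposed instead. This gives disjoint classes of permutations, each at least as large as the
  original one, and their number is at least \<open>card V - card S - card C\<close>.
\<close>
lemma card_extending_insert:
  assumes V: "finite V" and S: "S \<subseteq> V" and C: "finite C"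
    and ap: "a \<in> V" "p \<in> V" "a \<notin> fst ` C" "p \<notin> snd ` C"
  shows "card (extending V S (insert (a, p) C)) * (card V - card S - card C)
    \<le> card (extending V S C)"
proof -
  have finS: "finite S" using V S finite_subset by blast
  have size: "card V - card S - card C \<le> card (V - S - f ` C)" for f :: "'a \<times> 'a \<Rightarrow> 'a"
  proof -
    have "card V - card S = card (V - S)" using V S finS by (simp add: card_Diff_subset)
    moreover have "card (V - S) - card (f ` C) \<le> card (V - S - f ` C)"
      using C by (intro diff_card_le_card_Diff) auto
    ultimately show ?thesis using card_image_le[OF C, of f] by linarith
  qed
  consider "a \<notin> S" | "a \<in> S" "p \<in> S" | "a \<in> S" "p \<notin> S" by blast
  then show ?thesis
  proof cases
    case 1
    let ?I = "V - S - fst ` C"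
    have "card (extending V S (insert (a, p) C)) * card ?I \<le> card (extending V S C)"
    proof (rule card_le_by_disjoint_copies[where A = "\<lambda>c. extending V S (insert (c, p) C)"])
      fix c assume c: "c \<in> ?I"
      let ?f = "\<lambda>\<pi>. \<pi> \<circ> transpose a c"
      have "?f ` extending V S (insert (a, p) C) \<subseteq> extending V S (insert (c, p) C)"
      proof
        fix \<rho> assume "\<rho> \<in> ?f ` extending V S (insert (a, p) C)"
        then obtain \<pi> where \<pi>: "\<pi> permutes V" "\<forall>s\<in>S. \<pi> s \<notin> S" "\<pi> a = p"
          "\<And>b q. (b, q) \<in> C \<Longrightarrow> \<pi> b = q" "\<rho> = ?f \<pi>"
          unfolding extending_def avoiding_def by fastforce
        have "\<rho> permutes V"
          using \<pi>(1,5) ap c by (auto intro!: permutes_compose permutes_swap_id)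
        moreover have "\<rho> s \<notin> S" if "s \<in> S" for s
        proof -
          have "transpose a c s = s" using that 1 c by (auto simp: transpose_def)
          then show ?thesis using \<pi> that by simp
        qed
        moreover have "\<rho> b = q" if "(b, q) \<in> C" for b q
        proof -
          have "b \<in> fst ` C" using that by force
          then have "transpose a c b = b" using ap c by (auto simp: transpose_def)
          then show ?thesis using \<pi> that by simp
        qed
        ultimately show "\<rho> \<in> extending V S (insert (c, p) C)"
          unfolding extending_def avoiding_def using \<pi> by auto
      qed
      moreover have "inj_on ?f (extending V S (insert (a, p) C))"
        by (rule inj_onI) (metis comp_assoc comp_id transpose_comp_involutory)
      ultimately show "card (extending V S (insert (a, p) C)) \<le> card (extending V S (insert (c, p) C))"
        using card_inj_on_le finite_extending[OF V] by blast
    next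
      fix c c' assume "c \<in> ?I" "c' \<in> ?I" "c \<noteq> c'"
      then show "extending V S (insert (c, p) C) \<inter> extending V S (insert (c', p) C) = {}"
        unfolding extending_def avoiding_def by (auto dest!: permutes_inj simp: inj_eq)
    next
      show "finite (extending V S C)" by (rule finite_extending[OF V])
    qed (use V in \<open>auto simp: extending_def\<close>)
    then show ?thesis using size[of fst] by (meson le_trans mult_le_mono2)
  next
    case 2
    then have "extending V S (insert (a, p) C) = {}"
      unfolding extending_def avoiding_def by auto
    then show ?thesis by simp
  next
    case 3
    let ?I = "V - S - snd ` C"
    have "card (extending V S (insert (a, p) C)) * card ?I \<le> card (extending V S C)"
    proof (rule card_le_by_disjoint_copies[where A = "\<lambda>c. extending V S (insert (a, c) C)"])
      fix c assume c: "c \<in> ?I"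
      let ?f = "\<lambda>\<pi>. transpose p c \<circ> \<pi>"
      have "?f ` extending V S (insert (a, p) C) \<subseteq> extending V S (insert (a, c) C)"
      proof
        fix \<rho> assume "\<rho> \<in> ?f ` extending V S (insert (a, p) C)"
        then obtain \<pi> where \<pi>: "\<pi> permutes V" "\<forall>s\<in>S. \<pi> s \<notin> S" "\<pi> a = p"
          "\<And>b q. (b, q) \<in> C \<Longrightarrow> \<pi> b = q" "\<rho> = ?f \<pi>"
          unfolding extending_def avoiding_def by fastforce
        have "\<rho> permutes V"
          using \<pi>(1,5) ap c by (auto intro!: permutes_compose permutes_swap_id)
        moreover have "\<rho> s \<notin> S" if "s \<in> S" for s
          using \<pi>(2,5) that 3 c by (auto simp: transpose_def)
        moreover have "\<rho> b = q" if "(b, q) \<in> C" for b q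
        proof -
          have "q \<in> snd ` C" using that by force
          then have "transpose p c q = q" using ap c by (auto simp: transpose_def)
          then show ?thesis using \<pi> that by simp
        qed
        ultimately show "\<rho> \<in> extending V S (insert (a, c) C)"
          unfolding extending_def avoiding_def using \<pi> by auto
      qed
      moreover have "inj_on ?f (extending V S (insert (a, p) C))"
        by (rule inj_onI) (metis comp_assoc id_comp transpose_comp_involutory)
      ultimately show "card (extending V S (insert (a, p) C)) \<le> card (extending V S (insert (a, c) C))"
        using card_inj_on_le finite_extending[OF V] by blast
    next
      show "finite (extending V S C)" by (rule finite_extending[OF V])
    qed (use V in \<open>auto simp: extending_def\<close>)
    then show ?thesis using size[of snd] by (meson le_trans mult_le_mono2)
  qed
qed

text \<open>
  A random member of \<open>avoiding V S\<close> extends \<open>C\<close> with probability at most about \<open>n\<close> to the power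
  \<open>- card C\<close>. If \<open>C\<close> is not a partial injection, or requires an element of \<open>S\<close> to be mapped into \<open>S\<close>,
  then no member extends it; hence \<open>C\<close> may be any set of pairs.
\<close>
lemma card_extending_le:
  assumes V: "finite V" and S: "S \<subseteq> V"
    and "finite C" "C \<subseteq> V \<times> V" "card C \<le> Suc k"
  shows "card (extending V S C) * (card V - card S - k) ^ card C \<le> card (avoiding V S)"
  using assms(3-)
proof (induction C)
  case empty
  have "extending V S {} = avoiding V S" unfolding extending_def by auto
  then show ?case by simp
next
  case (insert x C)
  obtain a p where x: "x = (a, p)" by force
  let ?D = "card V - card S - k"
  show ?case
  proof (cases "a \<in> fst ` C \<or> p \<in> snd ` C")
    case True
    have "extending V S (insert x C) = {}"
    proof (rule ccontr)
      assume "extending V S (insert x C) \<noteq> {}"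
      then obtain \<pi> where \<pi>: "\<pi> permutes V" "\<pi> a = p" "\<And>b q. (b, q) \<in> C \<Longrightarrow> \<pi> b = q"
        unfolding extending_def avoiding_def x by fastforce
      from True obtain b q where bq: "(b, q) \<in> C" "b = a \<or> q = p" by force
      then have "\<pi> b = q" using \<pi> by auto
      then have "(b, q) = (a, p)" using bq(2) \<pi> permutes_inj[OF \<pi>(1)] by (auto simp: inj_eq)
      then show False using bq insert.hyps x by auto
    qed
    then show ?thesis by simp
  next
    case False
    have "card (extending V S (insert x C)) * ?D ^ card (insert x C)
      = card (extending V S (insert x C)) * ?D * ?D ^ card C"
      using insert.hyps by simp
    also have "\<dots> \<le> card (extending V S (insert x C)) * (card V - card S - card C) * ?D ^ card C"
      using insert.hyps insert.prems by (intro mult_le_mono) auto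
    also have "\<dots> \<le> card (extending V S C) * ?D ^ card C"
      using card_extending_insert[OF V S insert.hyps(1), of a p] False insert.prems
      unfolding x by (intro mult_le_mono) auto
    also have "\<dots> \<le> card (avoiding V S)" using insert by simp
    finally show ?thesis .
  qed
qed

text \<open>
  The first moment bound behind all the expectations below, written without division.
\<close>
lemma sum_card_extending_le:
  assumes V: "finite V" and S: "S \<subseteq> V" and X: "finite X"
    and C: "\<And>x. x \<in> X \<Longrightarrow> finite (C x) \<and> C x \<subseteq> V \<times> V \<and> card (C x) = j"
    and j: "j \<le> Suc k"
  shows "(\<Sum>\<pi>\<in>avoiding V S. card {x\<in>X. \<pi> \<in> extending V S (C x)}) * (card V - card S - k) ^ j
    \<le> card X * card (avoiding V S)"
proof -
  let ?P = "avoiding V S" and ?D = "card V - card S - k"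
  have "(\<Sum>\<pi>\<in>?P. card {x\<in>X. \<pi> \<in> extending V S (C x)})
    = (\<Sum>\<pi>\<in>?P. \<Sum>x\<in>X. if \<pi> \<in> extending V S (C x) then 1 else 0)"
    using X by (simp add: sum.If_cases Int_def)
  also have "\<dots> = (\<Sum>x\<in>X. \<Sum>\<pi>\<in>?P. if \<pi> \<in> extending V S (C x) then 1 else 0)"
    by (rule sum.swap)
  also have "\<dots> = (\<Sum>x\<in>X. card (extending V S (C x)))"
  proof (rule sum.cong[OF refl])
    fix x
    have "?P \<inter> extending V S (C x) = extending V S (C x)" unfolding extending_def by auto
    then show "(\<Sum>\<pi>\<in>?P. if \<pi> \<in> extending V S (C x) then 1 else 0) = card (extending V S (C x))"
      using finite_avoiding[OF V] by (simp add: sum.If_cases)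
  qed
  finally have "(\<Sum>\<pi>\<in>?P. card {x\<in>X. \<pi> \<in> extending V S (C x)}) * ?D ^ j
    = (\<Sum>x\<in>X. card (extending V S (C x)) * ?D ^ j)" by (simp only: sum_distrib_right)
  also have "\<dots> \<le> (\<Sum>x\<in>X. card ?P)"
    by (intro sum_mono) (metis C j card_extending_le[OF V S])
  finally show ?thesis by simp
qed

section \<open>Repairing loose arcs by transpositions\<close>

definition deg :: "('a \<times> 'a) set \<Rightarrow> 'a \<Rightarrow> nat" where
  "deg R v = card (R `` {v})"

definition shared :: "('a \<times> 'a) set \<Rightarrow> ('a \<Rightarrow> 'a) \<Rightarrow> ('a \<times> 'a) set" where
  "shared R \<pi> = {(a, b) \<in> R. (\<pi> a, \<pi> b) \<in> R}"

definition loose :: "'a set \<Rightarrow> ('a \<times> 'a) set \<Rightarrow> ('a \<Rightarrow> 'a) \<Rightarrow> ('a \<times> 'a) set" where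
  "loose S R \<pi> = {(a, b) \<in> shared R \<pi>. a \<notin> S \<and> \<pi> a \<notin> S}"

definition rigid :: "'a set \<Rightarrow> ('a \<times> 'a) set \<Rightarrow> ('a \<Rightarrow> 'a) \<Rightarrow> ('a \<times> 'a) set" where
  "rigid S R \<pi> = {(a, b) \<in> shared R \<pi>. (a \<in> S \<or> \<pi> a \<in> S) \<and> (b \<in> S \<or> \<pi> b \<in> S)}"

text \<open>
  An upper bound for the number of \<open>c\<close> such that exchanging the images of \<open>a\<close> and \<open>c\<close> creates a new
  shared edge: the first sum bounds the new ones at \<open>a\<close>, the second the new ones at \<open>c\<close>.
\<close>
definition load :: "('a \<times> 'a) set \<Rightarrow> ('a \<Rightarrow> 'a) \<Rightarrow> 'a \<Rightarrow> nat" where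
  "load R \<pi> a = (\<Sum>u\<in>R `` {a}. deg R (\<pi> u)) + (\<Sum>u\<in>\<pi> -` (R `` {\<pi> a}). deg R u)"

locale sym_arcs =
  fixes V :: "'a set" and R :: "('a \<times> 'a) set"
  assumes finite_V: "finite V" and R_sub: "R \<subseteq> V \<times> V"
    and sym: "(a, b) \<in> R \<Longrightarrow> (b, a) \<in> R" and irrefl: "(a, a) \<notin> R"
begin

lemma finite_R: "finite R"
  using R_sub finite_V finite_subset by blast

lemma in_V: "(a, b) \<in> R \<Longrightarrow> a \<in> V" "(a, b) \<in> R \<Longrightarrow> b \<in> V"
  using R_sub by auto

lemma finite_nbrs: "finite (R `` {a})"
  using finite_R by (simp add: finite_Image)

lemma finite_shared: "finite (shared R \<pi>)"
  unfolding shared_def using finite_R by (auto intro: finite_subset[of _ R])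

lemma finite_vimage_nbrs: "\<pi> permutes V \<Longrightarrow> finite (\<pi> -` (R `` {x}))"
  by (intro finite_vimageI finite_nbrs) (auto dest: permutes_inj)

lemma card_vimage_le: "\<pi> permutes V \<Longrightarrow> card (\<pi> -` A) = card A"
  by (metis card_vimage_inj permutes_inj permutes_surj subset_UNIV)

text \<open>
  The vertex \<open>c\<close> avoids \<open>S\<close>, the preimage of \<open>S\<close>, \<open>a\<close> with its neighbours, and the vertices counted
  by \<open>load\<close>. Then neither \<open>a\<close> nor \<open>c\<close> is on a shared arc after the exchange, while all other arcs
  are as before.
\<close>
lemma swap_away:
  assumes \<pi>: "\<pi> \<in> avoiding V S" and S: "S \<subseteq> V" and a: "a \<in> V" "a \<notin> S" "\<pi> a \<notin> S"
    and room: "load R \<pi> a + 2 * card S + 1 + deg R a < card V"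
  obtains c where "\<pi> \<circ> transpose a c \<in> avoiding V S" "c \<in> V" "c \<notin> S" "\<pi> c \<notin> S"
    "shared R (\<pi> \<circ> transpose a c) \<subseteq> {(x, y) \<in> shared R \<pi>. x \<notin> {a, c} \<and> y \<notin> {a, c}}"
proof -
  have p: "\<pi> permutes V" and av: "\<And>s. s \<in> S \<Longrightarrow> \<pi> s \<notin> S"
    using \<pi> unfolding avoiding_def by auto
  have finS: "finite S" using S finite_V finite_subset by blast
  let ?U = "\<Union>u\<in>R `` {a}. \<pi> -` (R `` {\<pi> u})" and ?W = "\<Union>u\<in>\<pi> -` (R `` {\<pi> a}). R `` {u}"
  let ?B = "S \<union> \<pi> -` S \<union> {a} \<union> R `` {a} \<union> ?U \<union> ?W"
  have U: "card ?U \<le> (\<Sum>u\<in>R `` {a}. deg R (\<pi> u))"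
    by (rule order_trans[OF card_UN_le[OF finite_nbrs]])
      (simp add: deg_def card_vimage_le[OF p])
  have W: "card ?W \<le> (\<Sum>u\<in>\<pi> -` (R `` {\<pi> a}). deg R u)"
    by (rule order_trans[OF card_UN_le[OF finite_vimage_nbrs[OF p]]]) (simp add: deg_def)
  have "card ?B \<le> card S + card (\<pi> -` S) + card {a} + card (R `` {a}) + card ?U + card ?W"
    by (intro order_trans[OF card_Un_le] add_mono order_refl)
  also have "\<dots> < card V"
    using U W room unfolding card_vimage_le[OF p] load_def deg_def by simp
  finally have less: "card ?B < card V" .
  have "finite ?B"
    using finS finite_nbrs finite_vimage_nbrs[OF p] finite_vimageI[OF finS permutes_inj[OF p]]
    by (intro finite_UnI finite_UN_I) auto
  then have "\<not> V \<subseteq> ?B" using less card_mono[of ?B V] by linarith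
  then obtain c where c: "c \<in> V" "c \<notin> ?B" by blast
  let ?q = "\<pi> \<circ> transpose a c"
  have qp: "?q permutes V" using p a c by (intro permutes_compose permutes_swap_id)
  have qa: "?q a = \<pi> c" and qc: "?q c = \<pi> a" by simp_all
  have qo: "?q x = \<pi> x" if "x \<noteq> a" "x \<noteq> c" for x using that by (simp add: transpose_def)
  have "?q \<in> avoiding V S"
    unfolding avoiding_def using qp qo av a c by fastforce
  moreover have "shared R ?q \<subseteq> {(x, y) \<in> shared R \<pi>. x \<notin> {a, c} \<and> y \<notin> {a, c}}"
  proof clarify
    fix x y assume "(x, y) \<in> shared R ?q"
    then have xy: "(x, y) \<in> R" "(?q x, ?q y) \<in> R" unfolding shared_def by auto
    have no: False if "(x, y) \<in> R" "(?q x, ?q y) \<in> R" "x \<in> {a, c}" for x y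
    proof (cases "y \<in> {a, c}")
      case True
      then have "(a, c) \<in> R" using that irrefl sym by auto
      then show False using c by auto
    next
      case False
      then have y: "?q y = \<pi> y" using qo by auto
      show False
      proof (cases "x = a")
        case True
        then have "(\<pi> y, \<pi> c) \<in> R" "(a, y) \<in> R" using that y qa sym by auto
        then show False using c by auto
      next
        case False
        then have "(\<pi> a, \<pi> y) \<in> R" "(y, c) \<in> R" using that y qc sym by auto
        then show False using c by auto
      qed
    qed
    from no[OF xy] no[OF sym[OF xy(1)] sym[OF xy(2)]] have "x \<notin> {a, c}" "y \<notin> {a, c}" by blast+
    then show "(x, y) \<in> shared R \<pi> \<and> x \<notin> {a, c} \<and> y \<notin> {a, c}"
      using xy qo unfolding shared_def by auto
  qed
  ultimately show ?thesis using that c by blast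
qed

lemma load_swap_le:
  assumes p: "\<pi> permutes V" and "a \<in> V" "c \<in> V" and x: "x \<noteq> a" "x \<noteq> c"
    and d: "deg R a \<le> d" "deg R c \<le> d" "deg R (\<pi> a) \<le> d" "deg R (\<pi> c) \<le> d"
  shows "load R (\<pi> \<circ> transpose a c) x \<le> load R \<pi> x + 4 * d"
proof -
  let ?q = "\<pi> \<circ> transpose a c"
  have qo: "?q y = \<pi> y" if "y \<noteq> a" "y \<noteq> c" for y using that by (simp add: transpose_def)
  have qp: "?q permutes V" using assms by (intro permutes_compose permutes_swap_id)
  have split: "(\<Sum>u\<in>A. f u) \<le> (\<Sum>u\<in>A - {a, c}. f u) + f a + f c"
    if "finite A" for A and f :: "'a \<Rightarrow> nat"
  proof -
    have "(\<Sum>u\<in>A. f u) \<le> (\<Sum>u\<in>(A - {a, c}) \<union> {a, c}. f u)"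
      using that by (intro sum_mono2) auto
    also have "\<dots> = (\<Sum>u\<in>A - {a, c}. f u) + (\<Sum>u\<in>{a, c}. f u)"
      using that by (intro sum.union_disjoint) auto
    also have "(\<Sum>u\<in>{a, c}. f u) \<le> f a + f c" by (cases "a = c") auto
    finally show ?thesis by simp
  qed
  let ?N = "R `` {x}"
  have "(\<Sum>u\<in>?N. deg R (?q u)) \<le> (\<Sum>u\<in>?N - {a, c}. deg R (?q u)) + 2 * d"
    using split[OF finite_nbrs, of "\<lambda>u. deg R (?q u)" x] d by simp
  also have "(\<Sum>u\<in>?N - {a, c}. deg R (?q u)) = (\<Sum>u\<in>?N - {a, c}. deg R (\<pi> u))"
    using qo by (intro sum.cong) auto
  also have "\<dots> \<le> (\<Sum>u\<in>?N. deg R (\<pi> u))"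
    by (intro sum_mono2) (auto simp: finite_nbrs)
  finally have 1: "(\<Sum>u\<in>?N. deg R (?q u)) \<le> (\<Sum>u\<in>?N. deg R (\<pi> u)) + 2 * d" by simp
  have qx: "?q x = \<pi> x" using qo x by blast
  let ?M = "?q -` (R `` {\<pi> x})" and ?M' = "\<pi> -` (R `` {\<pi> x})"
  have "(\<Sum>u\<in>?M. deg R u) \<le> (\<Sum>u\<in>?M - {a, c}. deg R u) + 2 * d"
    using split[OF finite_vimage_nbrs[OF qp], of "deg R" "\<pi> x"] d by simp
  also have "?M - {a, c} = ?M' - {a, c}" using qo by auto
  also have "(\<Sum>u\<in>?M' - {a, c}. deg R u) \<le> (\<Sum>u\<in>?M'. deg R u)"
    by (intro sum_mono2) (auto simp: finite_vimage_nbrs[OF p])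
  finally have 2: "(\<Sum>u\<in>?M. deg R u) \<le> (\<Sum>u\<in>?M'. deg R u) + 2 * d"
    by (simp only: add_le_cancel_right)
  show ?thesis unfolding load_def qx using 1 2 by linarith
qed

text \<open>
  Each exchange removes a loose arc and makes no new rigid one, but it may increase the load at the
  remaining loose arcs by \<open>4 * d\<close>; the hypothesis on the load allows for all \<open>k\<close> exchanges in advance.
\<close>
lemma repair:
  assumes S: "S \<subseteq> V" and d: "\<And>v. v \<in> V - S \<Longrightarrow> deg R v \<le> d"
  shows "\<pi> \<in> avoiding V S \<Longrightarrow> card (loose S R \<pi>) \<le> k \<Longrightarrow>
    (\<And>a b. (a, b) \<in> loose S R \<pi> \<Longrightarrow> load R \<pi> a + 4 * d * k + 2 * card S + 1 + d < card V) \<Longrightarrow>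
    \<exists>\<rho>\<in>avoiding V S. card (shared R \<rho>) \<le> card (rigid S R \<pi>)"
proof (induction k arbitrary: \<pi>)
  case 0
  have "finite (loose S R \<pi>)"
    by (rule finite_subset[OF _ finite_shared[of \<pi>]]) (auto simp: loose_def)
  then have "loose S R \<pi> = {}" using 0 by simp
  then have "shared R \<pi> \<subseteq> rigid S R \<pi>"
    unfolding loose_def rigid_def shared_def using sym by auto
  moreover have "finite (rigid S R \<pi>)"
    by (rule finite_subset[OF _ finite_shared[of \<pi>]]) (auto simp: rigid_def)
  ultimately show ?case using 0 card_mono by blast
next
  case (Suc k)
  show ?case
  proof (cases "loose S R \<pi> = {}")
    case True
    then have "card (loose S R \<pi>) \<le> k" by simp
    then show ?thesis using Suc.IH[of \<pi>] Suc.prems(1) True by blast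
  next
    case False
    then obtain a b where ab: "(a, b) \<in> loose S R \<pi>" by auto
    have p: "\<pi> permutes V" using Suc.prems(1) unfolding avoiding_def by simp
    have aV: "a \<in> V" "a \<notin> S" "\<pi> a \<notin> S" "\<pi> a \<in> V"
      using ab unfolding loose_def shared_def by (auto dest: in_V)
    have "load R \<pi> a + 2 * card S + 1 + deg R a < card V"
      using Suc.prems(3)[OF ab] d[of a] aV by auto
    from swap_away[OF Suc.prems(1) S aV(1-3) this] obtain c where
      c: "\<pi> \<circ> transpose a c \<in> avoiding V S" "c \<in> V" "c \<notin> S" "\<pi> c \<notin> S"
        "shared R (\<pi> \<circ> transpose a c) \<subseteq> {(x, y) \<in> shared R \<pi>. x \<notin> {a, c} \<and> y \<notin> {a, c}}"
      by blast
    let ?q = "\<pi> \<circ> transpose a c"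
    have qo: "?q y = \<pi> y" if "y \<noteq> a" "y \<noteq> c" for y using that by (simp add: transpose_def)
    have sh: "(x, y) \<in> shared R \<pi>" "x \<noteq> a" "x \<noteq> c" "?q x = \<pi> x" "?q y = \<pi> y"
      if "(x, y) \<in> shared R ?q" for x y
    proof -
      have "(x, y) \<in> {(x, y) \<in> shared R \<pi>. x \<notin> {a, c} \<and> y \<notin> {a, c}}" using c(5) that by blast
      then have "(x, y) \<in> shared R \<pi>" "x \<notin> {a, c}" "y \<notin> {a, c}" by auto
      then show "(x, y) \<in> shared R \<pi>" "x \<noteq> a" "x \<noteq> c" "?q x = \<pi> x" "?q y = \<pi> y"
        using qo[of x] qo[of y] by auto
    qed
    have loose: "(x, y) \<in> loose S R \<pi>" "x \<noteq> a" if "(x, y) \<in> loose S R ?q" for x y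
    proof -
      have *: "(x, y) \<in> shared R ?q" "x \<notin> S" "?q x \<notin> S" using that unfolding loose_def by blast+
      have "\<pi> x \<notin> S" using *(3) unfolding sh(4)[OF *(1)] .
      then show "(x, y) \<in> loose S R \<pi>" "x \<noteq> a"
        using sh(1,2)[OF *(1)] *(2) unfolding loose_def by blast+
    qed
    have rigid: "rigid S R ?q \<subseteq> rigid S R \<pi>"
    proof (rule subrelI)
      fix x y assume "(x, y) \<in> rigid S R ?q"
      then have *: "(x, y) \<in> shared R ?q" "x \<in> S \<or> ?q x \<in> S" "y \<in> S \<or> ?q y \<in> S"
        unfolding rigid_def by blast+
      then have "x \<in> S \<or> \<pi> x \<in> S" "y \<in> S \<or> \<pi> y \<in> S"
        unfolding sh(4)[OF *(1)] sh(5)[OF *(1)] by blast+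
      then show "(x, y) \<in> rigid S R \<pi>"
        using sh(1)[OF *(1)] unfolding rigid_def by blast
    qed
    have finl: "finite (loose S R \<pi>)"
      by (rule finite_subset[OF _ finite_shared[of \<pi>]]) (auto simp: loose_def)
    have finr: "finite (rigid S R \<pi>)"
      by (rule finite_subset[OF _ finite_shared[of \<pi>]]) (auto simp: rigid_def)
    have "card (loose S R ?q) \<le> card (loose S R \<pi> - {(a, b)})"
      using loose finl by (intro card_mono) force+
    then have "card (loose S R ?q) \<le> k" using ab finl Suc.prems(2) by simp
    moreover have "load R ?q x + 4 * d * k + 2 * card S + 1 + d < card V"
      if xy: "(x, y) \<in> loose S R ?q" for x y
    proof -
      have "(x, y) \<in> shared R ?q" using xy unfolding loose_def by blast
      note * = sh[OF this]
      have "\<pi> c \<in> V" using p c(2) permutes_in_image by metis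
      then have "load R ?q x \<le> load R \<pi> x + 4 * d"
        using aV c(2-4) by (intro load_swap_le[OF p aV(1) c(2) *(2,3)] d) auto
      moreover have "load R \<pi> x + 4 * d * Suc k + 2 * card S + 1 + d < card V"
        using loose(1)[OF xy] by (rule Suc.prems(3))
      ultimately show ?thesis by simp
    qed
    ultimately obtain \<rho> where "\<rho> \<in> avoiding V S" "card (shared R \<rho>) \<le> card (rigid S R ?q)"
      using Suc.IH[of ?q] c(1) by blast
    then show ?thesis using card_mono[OF finr rigid] le_trans by blast
  qed
qed

end

section \<open>Expected numbers of rigid and loose arcs\<close>

text \<open>
  Two arcs from the same vertex \<open>a\<close>, together with prescribed images \<open>(p, q)\<close> of the first arc and \<open>r\<close>
  of the end of the second one; the last arc \<open>(r, z)\<close> makes the number of choices count the degree of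
  \<open>r\<close>. For a loose arc \<open>(a, b)\<close>, the cherries at \<open>(a, b)\<close> whose matching is part of \<open>\<pi>\<close> count the first
  sum of \<open>load\<close> without the summand of \<open>b\<close>. The second sum is the first one for the inverse permutation, and therefore uses the
  converse of the matching.
\<close>
definition cherries :: "'a set \<Rightarrow> ('a \<times> 'a) set \<Rightarrow> ((('a \<times> 'a) \<times> 'a) \<times> ('a \<times> 'a) \<times> ('a \<times> 'a)) set" where
  "cherries S R = {(((a, b), u), (p, q), (r, z)).
     (a, b) \<in> R \<and> a \<notin> S \<and> (a, u) \<in> R \<and> u \<noteq> b \<and> (p, q) \<in> R \<and> (r, z) \<in> R}"

fun matching :: "(('a \<times> 'a) \<times> 'a) \<times> ('a \<times> 'a) \<times> ('a \<times> 'a) \<Rightarrow> ('a \<times> 'a) set" where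
  "matching (((a, b), u), (p, q), (r, z)) = {(a, p), (b, q), (u, r)}"

context sym_arcs
begin

lemma card_arcs_into: "card (R \<inter> UNIV \<times> S) = card (R \<inter> S \<times> UNIV)"
  by (rule bij_betw_same_card[of prod.swap])
    (auto intro!: bij_betwI[where g = prod.swap] dest: sym)

lemma sum_arc_pairs:
  assumes S: "S \<subseteq> V" and X: "X \<subseteq> R \<times> R"
    and Q: "\<And>\<pi> a b. \<pi> \<in> avoiding V S \<Longrightarrow> (a, b) \<in> Q \<pi> \<Longrightarrow> ((a, b), (\<pi> a, \<pi> b)) \<in> X"
  shows "(\<Sum>\<pi>\<in>avoiding V S. card (Q \<pi>)) * (card V - card S - 2) ^ 2
    \<le> card X * card (avoiding V S)"
proof -
  let ?C = "\<lambda>((a, b), (p, q)). {(a, p), (b, q)}"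
  have finX: "finite X" using finite_subset[OF X] finite_R by simp
  have C: "finite (?C x) \<and> ?C x \<subseteq> V \<times> V \<and> card (?C x) = 2" if "x \<in> X" for x
  proof -
    obtain a b p q where x: "x = ((a, b), (p, q))" by (metis prod.exhaust)
    then have "(a, b) \<in> R" "(p, q) \<in> R" using that X by auto
    moreover from this have "a \<noteq> b" using irrefl by auto
    ultimately show ?thesis unfolding x by (auto dest: in_V)
  qed
  have "(\<Sum>\<pi>\<in>avoiding V S. card (Q \<pi>))
    \<le> (\<Sum>\<pi>\<in>avoiding V S. card {x\<in>X. \<pi> \<in> extending V S (?C x)})"
  proof (rule sum_mono)
    fix \<pi> assume \<pi>: "\<pi> \<in> avoiding V S"
    then have "(\<lambda>(a, b). ((a, b), (\<pi> a, \<pi> b))) ` Q \<pi> \<subseteq> {x\<in>X. \<pi> \<in> extending V S (?C x)}"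
      using Q[OF \<pi>] unfolding extending_def by auto
    moreover have "inj_on (\<lambda>(a, b). ((a, b), (\<pi> a, \<pi> b))) (Q \<pi>)"
      by (auto intro: inj_onI)
    ultimately show "card (Q \<pi>) \<le> card {x\<in>X. \<pi> \<in> extending V S (?C x)}"
      using finX by (intro card_inj_on_le) auto
  qed
  then have "(\<Sum>\<pi>\<in>avoiding V S. card (Q \<pi>)) * (card V - card S - 2) ^ 2
    \<le> (\<Sum>\<pi>\<in>avoiding V S. card {x\<in>X. \<pi> \<in> extending V S (?C x)}) * (card V - card S - 2) ^ 2"
    by (rule mult_le_mono1)
  also have "\<dots> \<le> card X * card (avoiding V S)"
    by (rule sum_card_extending_le[OF finite_V S finX C]) simp_all
  finally show ?thesis .
qed

text \<open>
  The two main cases for a rigid arc \<open>(a, b)\<close> with image \<open>(p, q)\<close> are \<open>a, q \<in> S\<close> and \<open>b, p \<in> S\<close>; each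
  leaves at most \<open>card (R \<inter> S \<times> UNIV)\<close> choices for either arc. In the other two cases \<open>a, b \<in> S\<close> or
  \<open>p, q \<in> S\<close> one of the arcs is inside \<open>S\<close>, which leaves boundedly many choices for it.
\<close>
lemma sum_rigid:
  assumes S: "S \<subseteq> V"
  shows "(\<Sum>\<pi>\<in>avoiding V S. card (rigid S R \<pi>)) * (card V - card S - 2) ^ 2
    \<le> 2 * (card (R \<inter> S \<times> UNIV) ^ 2 + card S ^ 2 * card R) * card (avoiding V S)"
proof -
  let ?A = "R \<inter> S \<times> UNIV" and ?B = "R \<inter> UNIV \<times> S" and ?I = "R \<inter> S \<times> S"
  let ?X = "?I \<times> R \<union> R \<times> ?I \<union> ?A \<times> ?B \<union> ?B \<times> ?A"
  have finS: "finite S" using S finite_V finite_subset by blast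
  have I: "card ?I \<le> card S ^ 2"
    using card_mono[of "S \<times> S" ?I] finS by (simp add: power2_eq_square)
  have "card ?X \<le> card (?I \<times> R) + card (R \<times> ?I) + card (?A \<times> ?B) + card (?B \<times> ?A)"
    by (intro order_trans[OF card_Un_le] add_mono order_refl)
  also have "\<dots> = 2 * (card ?A ^ 2 + card ?I * card R)"
    by (simp only: card_cartesian_product card_arcs_into) (simp add: algebra_simps power2_eq_square)
  also have "\<dots> \<le> 2 * (card ?A ^ 2 + card S ^ 2 * card R)"
    using I by (intro mult_le_mono add_le_mono) auto
  finally have "card ?X * card (avoiding V S)
      \<le> 2 * (card ?A ^ 2 + card S ^ 2 * card R) * card (avoiding V S)"
    by (rule mult_le_mono1)
  moreover have "(\<Sum>\<pi>\<in>avoiding V S. card (rigid S R \<pi>)) * (card V - card S - 2) ^ 2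
      \<le> card ?X * card (avoiding V S)"
    by (rule sum_arc_pairs[OF S]) (auto simp: rigid_def shared_def)
  ultimately show ?thesis by (rule order_trans[rotated])
qed

lemma sum_loose:
  assumes S: "S \<subseteq> V"
  shows "(\<Sum>\<pi>\<in>avoiding V S. card (loose S R \<pi>)) * (card V - card S - 2) ^ 2
    \<le> card R ^ 2 * card (avoiding V S)"
  using sum_arc_pairs[OF S, of "R \<times> R" "loose S R"]
  by (simp add: loose_def shared_def power2_eq_square card_cartesian_product)

lemma cherries_eq:
  "cherries S R = (SIGMA (a, b) : R \<inter> (- S) \<times> UNIV. R `` {a} - {b}) \<times> R \<times> R"
  unfolding cherries_def by auto

lemma finite_cherries: "finite (cherries S R)"
  unfolding cherries_eq using finite_R finite_nbrs by (intro finite_cartesian_product finite_SigmaI) auto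

lemma card_cherries:
  assumes d: "\<And>v. v \<in> V - S \<Longrightarrow> deg R v \<le> d"
  shows "card (cherries S R) \<le> d * card R ^ 3"
proof -
  let ?A = "R \<inter> (- S) \<times> UNIV"
  have "card (SIGMA (a, b) : ?A. R `` {a} - {b}) = (\<Sum>(a, b)\<in>?A. card (R `` {a} - {b}))"
    using finite_R finite_nbrs by (subst card_SigmaI) (auto simp: case_prod_unfold)
  also have "\<dots> \<le> (\<Sum>(a, b)\<in>?A. d)"
  proof (intro sum_mono, clarify)
    fix a b assume "(a, b) \<in> R" "a \<notin> S"
    then have "deg R a \<le> d" using d in_V by auto
    then show "card (R `` {a} - {b}) \<le> d"
      unfolding deg_def using card_mono[OF finite_nbrs, of "R `` {a} - {b}" a] by auto
  qed
  also have "\<dots> \<le> card R * d"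
    using card_mono[OF finite_R, of ?A] by (simp add: case_prod_unfold)
  finally have "card (cherries S R) \<le> card R * d * (card R * card R)"
    unfolding cherries_eq card_cartesian_product by (rule mult_le_mono1)
  then show ?thesis by (simp add: power3_eq_cube ac_simps)
qed

lemma sum_cherries:
  assumes S: "S \<subseteq> V" and d: "\<And>v. v \<in> V - S \<Longrightarrow> deg R v \<le> d"
  shows "(\<Sum>\<pi>\<in>avoiding V S. card {x \<in> cherries S R. \<pi> \<in> extending V S (matching x)})
      * (card V - card S - 2) ^ 3 \<le> d * card R ^ 3 * card (avoiding V S)"
    and "(\<Sum>\<pi>\<in>avoiding V S. card {x \<in> cherries S R. \<pi> \<in> extending V S ((matching x)\<inverse>)})
      * (card V - card S - 2) ^ 3 \<le> d * card R ^ 3 * card (avoiding V S)"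
proof -
  have m: "finite (matching x) \<and> matching x \<subseteq> V \<times> V \<and> card (matching x) = 3"
    if "x \<in> cherries S R" for x
  proof -
    obtain a b u p q r z where x: "x = (((a, b), u), (p, q), (r, z))" by (metis prod.exhaust)
    then have "(a, b) \<in> R" "(a, u) \<in> R" "u \<noteq> b" "(p, q) \<in> R" "(r, z) \<in> R"
      using that unfolding cherries_def by auto
    moreover from this have "a \<noteq> b" "a \<noteq> u" using irrefl by auto
    ultimately show ?thesis unfolding x by (auto dest: in_V)
  qed
  have m': "finite ((matching x)\<inverse>) \<and> (matching x)\<inverse> \<subseteq> V \<times> V \<and> card ((matching x)\<inverse>) = 3"
    if "x \<in> cherries S R" for x
    using m[OF that] by (auto simp: card_inverse)
  have c: "card (cherries S R) * card (avoiding V S) \<le> d * card R ^ 3 * card (avoiding V S)"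
    using card_cherries[OF d] by (rule mult_le_mono1)
  show "(\<Sum>\<pi>\<in>avoiding V S. card {x \<in> cherries S R. \<pi> \<in> extending V S (matching x)})
      * (card V - card S - 2) ^ 3 \<le> d * card R ^ 3 * card (avoiding V S)"
    by (rule order_trans[OF sum_card_extending_le[OF finite_V S finite_cherries m] c]) simp_all
  show "(\<Sum>\<pi>\<in>avoiding V S. card {x \<in> cherries S R. \<pi> \<in> extending V S ((matching x)\<inverse>)})
      * (card V - card S - 2) ^ 3 \<le> d * card R ^ 3 * card (avoiding V S)"
    by (rule order_trans[OF sum_card_extending_le[OF finite_V S finite_cherries m'] c]) simp_all
qed

text \<open>
  The two summands that are not counted by cherries belong to the other end \<open>b\<close> of the shared arc. Only
  they can be linear in \<open>card V\<close>, namely if \<open>b\<close> or \<open>\<pi> b\<close> is in \<open>S\<close>.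
\<close>
lemma load_le:
  assumes \<pi>: "\<pi> \<in> avoiding V S" and ab: "(a, b) \<in> loose S R \<pi>"
  shows "load R \<pi> a \<le> deg R b + deg R (\<pi> b)
    + card {x \<in> cherries S R. \<pi> \<in> extending V S (matching x)}
    + card {x \<in> cherries S R. \<pi> \<in> extending V S ((matching x)\<inverse>)}"
proof -
  have p: "\<pi> permutes V" using \<pi> unfolding avoiding_def by simp
  have inj: "\<pi> x = \<pi> y \<longleftrightarrow> x = y" for x y using permutes_inj[OF p] by (simp add: inj_eq)
  have ab': "(a, b) \<in> R" "(\<pi> a, \<pi> b) \<in> R" "a \<notin> S" "\<pi> a \<notin> S"
    using ab unfolding loose_def shared_def by auto
  let ?N = "R `` {a}" and ?M = "\<pi> -` (R `` {\<pi> a})"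
  have "(\<Sum>u\<in>?N. deg R (\<pi> u)) = deg R (\<pi> b) + (\<Sum>u\<in>?N - {b}. deg R (\<pi> u))"
    using ab' finite_nbrs by (intro sum.remove) auto
  also have "(\<Sum>u\<in>?N - {b}. deg R (\<pi> u)) = card (SIGMA u : ?N - {b}. R `` {\<pi> u})"
    using finite_nbrs by (simp add: card_SigmaI deg_def)
  also have "\<dots> \<le> card {x \<in> cherries S R. \<pi> \<in> extending V S (matching x)}"
  proof (rule card_inj_on_le)
    let ?f = "\<lambda>(u, z). (((a, b), u), (\<pi> a, \<pi> b), (\<pi> u, z))"
    show "inj_on ?f (SIGMA u : ?N - {b}. R `` {\<pi> u})" by (auto intro: inj_onI)
    show "?f ` (SIGMA u : ?N - {b}. R `` {\<pi> u})
      \<subseteq> {x \<in> cherries S R. \<pi> \<in> extending V S (matching x)}"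
      using ab' \<pi> by (auto simp: cherries_def extending_def)
  qed (simp add: finite_cherries)
  finally have 1: "(\<Sum>u\<in>?N. deg R (\<pi> u))
    \<le> deg R (\<pi> b) + card {x \<in> cherries S R. \<pi> \<in> extending V S (matching x)}" by simp
  have "(\<Sum>u\<in>?M. deg R u) = deg R b + (\<Sum>u\<in>?M - {b}. deg R u)"
    using ab' finite_vimage_nbrs[OF p] by (intro sum.remove) auto
  also have "(\<Sum>u\<in>?M - {b}. deg R u) = card (SIGMA u : ?M - {b}. R `` {u})"
    using finite_nbrs finite_vimage_nbrs[OF p] by (simp add: card_SigmaI deg_def)
  also have "\<dots> \<le> card {x \<in> cherries S R. \<pi> \<in> extending V S ((matching x)\<inverse>)}"
  proof (rule card_inj_on_le)
    let ?f = "\<lambda>(u, z). (((\<pi> a, \<pi> b), \<pi> u), (a, b), (u, z))"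
    show "inj_on ?f (SIGMA u : ?M - {b}. R `` {u})" by (auto intro: inj_onI)
    show "?f ` (SIGMA u : ?M - {b}. R `` {u})
      \<subseteq> {x \<in> cherries S R. \<pi> \<in> extending V S ((matching x)\<inverse>)}"
      using ab' \<pi> inj by (auto simp: cherries_def extending_def)
  qed (simp add: finite_cherries)
  finally have 2: "(\<Sum>u\<in>?M. deg R u)
    \<le> deg R b + card {x \<in> cherries S R. \<pi> \<in> extending V S ((matching x)\<inverse>)}" by simp
  show ?thesis unfolding load_def using 1 2 by linarith
qed

lemma avoiding_nonempty:
  assumes S: "S \<subseteq> V" and c: "2 * card S \<le> card V"
  shows "avoiding V S \<noteq> {}"
proof -
  have finS: "finite S" using S finite_V finite_subset by blast
  have "card S \<le> card (V - S)" using S c finS by (simp add: card_Diff_subset)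
  then obtain f where f: "f ` S \<subseteq> V - S" "inj_on f S"
    using card_le_inj[OF finS finite_Diff[OF finite_V]] by blast
  define \<pi> where "\<pi> x = (if x \<in> S then f x else if x \<in> f ` S then inv_into S f x else x)" for x
  have i: "inv_into S f (f s) = s" if "s \<in> S" for s using f(2) that by simp
  have inv: "\<pi> (\<pi> x) = x" for x
    unfolding \<pi>_def using f i by auto
  have "\<pi> permutes V"
    unfolding permutes_def using f S inv by (metis DiffE \<pi>_def image_subset_iff subsetD)
  then have "\<pi> \<in> avoiding V S" unfolding avoiding_def \<pi>_def using f by auto
  then show ?thesis by blast
qed


text \<open>
  The expected number of rigid arcs is at most about \<open>2 * k + 1\<close>. To it are added the expected number
  of loose arcs and the expected number of cherries, with weights so small that the sum stays below
  \<open>2 * k + 2\<close>. A permutation that achieves less than \<open>2 * k + 2\<close> has few rigid arcs, boundedly many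
  loose arcs and little load, so it can be repaired.
\<close>
lemma packing:
  assumes S: "S \<subseteq> V" and n: "10 ^ 20 \<le> card V" and s: "card S \<le> 10 ^ 7"
    and R: "card R \<le> 4 * card V" and A: "2 * card (R \<inter> S \<times> UNIV) ^ 2 \<le> (2 * k + 1) * card V ^ 2"
    and k: "k \<le> 4"
    and small: "\<And>v. v \<in> V - S \<Longrightarrow> 2000000 * deg R v \<le> card V"
    and large: "\<And>v. v \<in> V \<Longrightarrow> 20 * deg R v \<le> 19 * card V"
  shows "\<exists>\<pi>. \<pi> permutes V \<and> (\<forall>s\<in>S. \<pi> s \<notin> S) \<and> card (shared R \<pi>) < 2 * k + 2"
proof -
  let ?P = "avoiding V S"
  define d where "d = card V div 2000000"
  have d: "deg R v \<le> d" if "v \<in> V - S" for v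
    using small[OF that] unfolding d_def by linarith
  define D where "D = card V - card S - 2"
  define m1 where "m1 \<pi> = card {x \<in> cherries S R. \<pi> \<in> extending V S (matching x)}" for \<pi>
  define m2 where "m2 \<pi> = card {x \<in> cherries S R. \<pi> \<in> extending V S ((matching x)\<inverse>)}" for \<pi>
  define N where "N = real (card V)"
  define r where "r = real (card R)"
  define P where "P = real (card ?P)"
  have N: "10 ^ 20 \<le> N" using n unfolding N_def by (metis of_nat_le_iff of_nat_numeral of_nat_power)
  have r: "0 \<le> r" "r \<le> 4 * N" using R unfolding r_def N_def by linarith+
  have D: "0.999 * N \<le> real D"
  proof -
    have "real D = N - real (card S) - 2" unfolding D_def N_def using n s by (simp add: of_nat_diff)
    moreover have "real (card S) \<le> 10 ^ 7" using s by (simp add: of_nat_le_iff[symmetric])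
    ultimately show ?thesis using N by simp
  qed
  have dN: "real d \<le> N / 2000000" unfolding d_def N_def by linarith
  have finP: "finite ?P" by (rule finite_avoiding[OF finite_V])
  have neP: "?P \<noteq> {}" using n s by (intro avoiding_nonempty[OF S]) simp
  have P: "0 < P" unfolding P_def using finP neP by (simp add: card_gt_0_iff)
  have D2: "0.998 * N ^ 2 \<le> real D ^ 2"
  proof -
    have "(0.999 * N) ^ 2 \<le> real D ^ 2" using D N by (intro power_mono) auto
    moreover have "0.998 * N ^ 2 \<le> (0.999 * N) ^ 2" using N by (simp add: power_mult_distrib power2_eq_square)
    ultimately show ?thesis by linarith
  qed
  have D3: "0.997 * N ^ 3 \<le> real D ^ 3"
  proof -
    have "(0.999 * N) ^ 3 \<le> real D ^ 3" using D N by (intro power_mono) auto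
    moreover have "0.997 * N ^ 3 \<le> (0.999 * N) ^ 3" using N by (simp add: power_mult_distrib power3_eq_cube)
    ultimately show ?thesis by linarith
  qed
  have rigid: "(\<Sum>\<pi>\<in>?P. real (card (rigid S R \<pi>))) \<le> (2 * k + 1.05) * P"
  proof -
    let ?a = "real (card (R \<inter> S \<times> UNIV))" and ?s = "real (card S)"
    let ?X = "\<Sum>\<pi>\<in>?P. real (card (rigid S R \<pi>))"
    have "?X * real D ^ 2 \<le> (2 * ?a ^ 2 + 2 * (?s ^ 2 * r)) * P"
      using of_nat_mono[OF sum_rigid[OF S], where 'a = real]
      unfolding D_def[symmetric] r_def P_def by (simp add: algebra_simps)
    also have "2 * ?a ^ 2 + 2 * (?s ^ 2 * r) \<le> (2 * k + 1.05) * real D ^ 2"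
    proof -
      have "2 * ?a ^ 2 \<le> (2 * k + 1) * N ^ 2"
        using of_nat_mono[OF A, where 'a = real] unfolding N_def by (simp add: algebra_simps)
      moreover have "?s ^ 2 * r \<le> (10 ^ 7) ^ 2 * (4 * N)"
        using s r by (intro mult_mono power_mono) auto
      moreover have "2 * ((10 ^ 7) ^ 2 * (4 * N)) \<le> 0.01 * N ^ 2"
        using mult_right_mono[OF N, of N] N by (simp add: power2_eq_square)
      ultimately have "2 * ?a ^ 2 + 2 * (?s ^ 2 * r) \<le> (2 * k + 1.01) * N ^ 2"
        by (simp add: algebra_simps)
      also have "\<dots> \<le> ((2 * k + 1.05) * 0.998) * N ^ 2"
        using k by (intro mult_right_mono) auto
      also have "\<dots> \<le> (2 * k + 1.05) * real D ^ 2"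
        using D2 unfolding mult.assoc by (intro mult_left_mono) auto
      finally show ?thesis .
    qed
    finally have "?X * real D ^ 2 \<le> ((2 * k + 1.05) * P) * real D ^ 2"
      using P by (simp add: mult_right_mono mult_ac)
    moreover have "0 < real D ^ 2" using D N by simp
    ultimately show ?thesis by (rule mult_right_le_imp_le)
  qed
  have loose: "(\<Sum>\<pi>\<in>?P. real (card (loose S R \<pi>))) \<le> 17 * P"
  proof -
    let ?X = "\<Sum>\<pi>\<in>?P. real (card (loose S R \<pi>))"
    have "?X * real D ^ 2 \<le> r ^ 2 * P"
      using of_nat_mono[OF sum_loose[OF S], where 'a = real]
      unfolding D_def[symmetric] r_def P_def by (simp add: algebra_simps)
    also have "r ^ 2 \<le> 17 * real D ^ 2"
    proof -
      have "r ^ 2 \<le> (4 * N) ^ 2" using r by (intro power_mono) auto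
      also have "\<dots> = 16 * N ^ 2" by (simp add: power_mult_distrib)
      also have "\<dots> \<le> 17 * (0.998 * N ^ 2)" by simp
      finally show ?thesis using D2 by linarith
    qed
    finally have "?X * real D ^ 2 \<le> (17 * P) * real D ^ 2"
      using P by (simp add: mult_right_mono mult_ac)
    moreover have "0 < real D ^ 2" using D N by simp
    ultimately show ?thesis by (rule mult_right_le_imp_le)
  qed
  have cherry: "X \<le> 0.0001 * N * P" if "X * real D ^ 3 \<le> real d * r ^ 3 * P" for X
  proof -
    have "real d * r ^ 3 \<le> (N / 2000000) * (4 * N) ^ 3"
      using r dN N by (intro mult_mono power_mono) auto
    also have "\<dots> \<le> 0.0001 * N * (0.997 * N ^ 3)"
      using N by (simp add: power_mult_distrib)
    also have "\<dots> \<le> 0.0001 * N * real D ^ 3"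
      using D3 N by (intro mult_left_mono) auto
    finally have "X * real D ^ 3 \<le> (0.0001 * N * P) * real D ^ 3"
      using that P by (smt (verit) mult.commute mult.left_commute mult_left_mono)
    moreover have "0 < real D ^ 3" using D N by simp
    ultimately show ?thesis by (rule mult_right_le_imp_le)
  qed
  note cherries = sum_cherries[OF S d, folded D_def m1_def m2_def]
  have m1: "(\<Sum>\<pi>\<in>?P. real (m1 \<pi>)) \<le> 0.0001 * N * P"
    using of_nat_mono[OF cherries(1), where 'a = real] unfolding r_def P_def[symmetric]
    by (intro cherry) (simp add: r_def P_def)
  have m2: "(\<Sum>\<pi>\<in>?P. real (m2 \<pi>)) \<le> 0.0001 * N * P"
    using of_nat_mono[OF cherries(2), where 'a = real] unfolding r_def P_def[symmetric]
    by (intro cherry) (simp add: r_def P_def)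
  \<comment> \<open>The weight 1/100 limits the loose arcs to 1000, and the weight 1000/N limits the cherries to N/100.
    In the mean the loose arcs contribute at most 17/100 and the cherries at most 2/10.\<close>
  define \<phi> where "\<phi> \<pi> = real (card (rigid S R \<pi>)) + real (card (loose S R \<pi>)) / 100
    + 1000 / N * (real (m1 \<pi>) + real (m2 \<pi>))" for \<pi>
  have "\<exists>\<pi>\<in>?P. \<phi> \<pi> < 2 * k + 2"
  proof (rule ccontr)
    assume "\<not> (\<exists>\<pi>\<in>?P. \<phi> \<pi> < 2 * k + 2)"
    then have "(2 * k + 2) * P \<le> (\<Sum>\<pi>\<in>?P. \<phi> \<pi>)"
      using sum_mono[of ?P "\<lambda>_. real (2 * k + 2)" \<phi>] unfolding P_def by (auto simp: not_less mult.commute)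
    also have "\<dots> = (\<Sum>\<pi>\<in>?P. real (card (rigid S R \<pi>))) + (\<Sum>\<pi>\<in>?P. real (card (loose S R \<pi>))) / 100
        + 1000 / N * ((\<Sum>\<pi>\<in>?P. real (m1 \<pi>)) + (\<Sum>\<pi>\<in>?P. real (m2 \<pi>)))"
      unfolding \<phi>_def by (simp add: sum.distrib sum_distrib_left sum_divide_distrib distrib_left)
    also have "\<dots> \<le> (2 * k + 1.05) * P + 17 * P / 100 + 1000 / N * (0.0001 * N * P + 0.0001 * N * P)"
      using rigid loose m1 m2 N by (intro add_mono mult_left_mono divide_right_mono) auto
    also have "\<dots> = (2 * k + 1.42) * P" using N by (simp add: field_simps)
    also have "\<dots> < (2 * k + 2) * P" using P by (intro mult_strict_right_mono) auto
    finally show False by simp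
  qed
  then obtain \<pi> where \<pi>: "\<pi> \<in> ?P" "\<phi> \<pi> < 2 * k + 2" by blast
  have pos: "0 \<le> 1000 / N * (real (m1 \<pi>) + real (m2 \<pi>))" using N by simp
  have r1: "card (rigid S R \<pi>) < 2 * k + 2" using \<pi>(2) pos unfolding \<phi>_def by linarith
  have l1: "card (loose S R \<pi>) \<le> 1000" using \<pi>(2) pos k unfolding \<phi>_def by linarith
  have "1000 / N * (real (m1 \<pi>) + real (m2 \<pi>)) < 10" using \<pi>(2) k unfolding \<phi>_def by linarith
  then have m: "real (m1 \<pi>) + real (m2 \<pi>) < N / 100" using N by (simp add: field_simps)
  have load: "load R \<pi> a + 4 * d * 1000 + 2 * card S + 1 + d < card V" if ab: "(a, b) \<in> loose S R \<pi>" for a b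
  proof -
    have "\<pi> permutes V" using \<pi>(1) unfolding avoiding_def by simp
    moreover have "b \<in> V" using ab unfolding loose_def shared_def by (auto dest: in_V)
    ultimately have b: "b \<in> V" "\<pi> b \<in> V" by (auto simp: permutes_in_image)
    \<comment> \<open>Since S is moved off itself, at most one of b and its image has linear degree.\<close>
    have "b \<notin> S \<or> \<pi> b \<notin> S" using \<pi>(1) unfolding avoiding_def by auto
    then have "deg R b \<le> d \<or> deg R (\<pi> b) \<le> d" using d b by auto
    then have "20 * (deg R b + deg R (\<pi> b)) \<le> 19 * card V + 20 * d"
      using large[OF b(1)] large[OF b(2)] by auto
    then have "real (deg R b) + real (deg R (\<pi> b)) \<le> 19 / 20 * N + real d"
      using of_nat_mono[where 'a = real] unfolding N_def by fastforce
    moreover have "real (load R \<pi> a) \<le> real (deg R b) + real (deg R (\<pi> b)) + real (m1 \<pi>) + real (m2 \<pi>)"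
      using of_nat_mono[OF load_le[OF \<pi>(1) ab], where 'a = real] unfolding m1_def m2_def by simp
    moreover have "real (card S) \<le> 10000000" "100000000000 \<le> N" using s N by simp_all
    ultimately have "real (load R \<pi> a) + 4 * real d * 1000 + 2 * real (card S) + 1 + real d < N"
      using m dN by linarith
    then show ?thesis unfolding N_def by linarith
  qed
  have "\<exists>\<rho>\<in>?P. card (shared R \<rho>) \<le> card (rigid S R \<pi>)"
    by (rule repair[OF S _ \<pi>(1) l1]) (erule d load)+
  then obtain \<rho> where "\<rho> \<in> ?P" "card (shared R \<rho>) \<le> card (rigid S R \<pi>)" by blast
  then show ?thesis using r1 unfolding avoiding_def by (auto intro!: exI[of _ \<rho>])
qed

end

section \<open>Exchanging a few vertices by hand\<close>

context sym_arcs
begin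

lemma restrict: "W \<subseteq> V \<Longrightarrow> sym_arcs W (R \<inter> W \<times> W)"
  using finite_V finite_subset sym irrefl by (unfold_locales) auto

lemma card_arcs_from: "finite S \<Longrightarrow> card (R \<inter> S \<times> UNIV) = (\<Sum>v\<in>S. deg R v)"
proof -
  assume "finite S"
  moreover have "R \<inter> S \<times> UNIV = (SIGMA v : S. R `` {v})" by auto
  ultimately show ?thesis using finite_nbrs by (simp add: deg_def)
qed

lemma sum_deg: "(\<Sum>v\<in>V. deg R v) = card R"
proof -
  have "R \<inter> V \<times> UNIV = R" using R_sub by auto
  then show ?thesis using card_arcs_from[OF finite_V] by simp
qed

lemma card_arcs_outside:
  assumes "U \<subseteq> V"
  shows "card (R \<inter> (V - U) \<times> (V - U)) + 2 * card (R \<inter> U \<times> UNIV) = card R + card (R \<inter> U \<times> U)"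
proof -
  let ?A = "R \<inter> U \<times> UNIV" and ?B = "R \<inter> UNIV \<times> U" and ?R' = "R \<inter> (V - U) \<times> (V - U)"
  have "R = ?R' \<union> (?A \<union> ?B)" using R_sub by auto
  then have "card R = card (?R' \<union> (?A \<union> ?B))" by (rule arg_cong)
  also have "\<dots> = card ?R' + card (?A \<union> ?B)" using finite_R by (intro card_Un_disjoint) auto
  finally have 1: "card R = card ?R' + card (?A \<union> ?B)" .
  have "?A \<inter> ?B = R \<inter> U \<times> U" by auto
  then have "card ?A + card ?B = card (?A \<union> ?B) + card (R \<inter> U \<times> U)"
    using card_Un_Int[of ?A ?B] finite_R by simp
  then show ?thesis using 1 card_arcs_into[of U] by linarith
qed

text \<open>
  Only arcs inside \<open>S\<close> can be counted together with their reversals.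
\<close>
lemma card_arcs_from_le: "S \<subseteq> V \<Longrightarrow> 2 * card (R \<inter> S \<times> UNIV) \<le> card R + card S ^ 2"
proof -
  assume S: "S \<subseteq> V"
  have "card (R \<inter> S \<times> S) \<le> card (S \<times> S)"
    using S finite_V by (intro card_mono) (auto intro: finite_subset)
  then show ?thesis using card_arcs_outside[OF S] by (simp add: card_cartesian_product power2_eq_square)
qed

text \<open>
  A version of \<open>packing\<close> that chooses the set \<open>S\<close> itself: \<open>T\<close> together with the vertices of linear
  degree, of which there are at most \<open>8000000\<close>. The parameter \<open>c / 10\<close> bounds the number of arcs from
  such a set in units of \<open>card V\<close>. Elements of \<open>T\<close> are not mapped to each other, which makes it possible
  to exclude a few unwanted values of the permutation.
\<close>
lemma packing_around:
  assumes n: "10 ^ 20 \<le> card V" and R: "card R \<le> 4 * card V" and k: "k \<le> 4"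
    and T: "T \<subseteq> V" "card T \<le> 4"
    and large: "\<And>v. v \<in> V \<Longrightarrow> 20 * deg R v \<le> 19 * card V"
    and A: "\<And>S. S \<subseteq> V \<Longrightarrow> card S \<le> 10 ^ 7 \<Longrightarrow> 10 * card (R \<inter> S \<times> UNIV) \<le> c * card V"
    and c: "2 * c ^ 2 \<le> 100 * (2 * k + 1)"
  shows "\<exists>\<pi>. \<pi> permutes V \<and> (\<forall>s\<in>T. \<pi> s \<notin> T) \<and> card (shared R \<pi>) < 2 * k + 2"
proof -
  let ?L = "{v \<in> V. card V < 2000000 * deg R v}"
  let ?S = "?L \<union> T"
  have S: "?S \<subseteq> V" using T by auto
  have "card ?L * card V = (\<Sum>v\<in>?L. card V)" by simp
  also have "\<dots> \<le> (\<Sum>v\<in>?L. 2000000 * deg R v)" by (intro sum_mono) auto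
  also have "\<dots> \<le> (\<Sum>v\<in>V. 2000000 * deg R v)" using finite_V by (intro sum_mono2) auto
  also have "\<dots> = 2000000 * card R" by (simp add: sum_distrib_left[symmetric] sum_deg)
  also have "\<dots> \<le> 8000000 * card V" using R by simp
  finally have "card ?L \<le> 8000000" using n by simp
  then have s: "card ?S \<le> 10 ^ 7" using T card_Un_le[of ?L T] by simp
  have "(10 * card (R \<inter> ?S \<times> UNIV)) ^ 2 \<le> (c * card V) ^ 2"
    using A[OF S s] by (rule power_mono) simp
  then have "2 * (100 * card (R \<inter> ?S \<times> UNIV) ^ 2) \<le> (2 * c ^ 2) * card V ^ 2"
    by (simp add: power_mult_distrib)
  also have "\<dots> \<le> (100 * (2 * k + 1)) * card V ^ 2" using c by (rule mult_le_mono1)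
  finally have "2 * card (R \<inter> ?S \<times> UNIV) ^ 2 \<le> (2 * k + 1) * card V ^ 2" by linarith
  moreover have "2000000 * deg R v \<le> card V" if "v \<in> V - ?S" for v
    using that by auto
  ultimately show ?thesis using packing[OF S n s R _ k _ large] by blast
qed

text \<open>
  For a permutation composed of \<open>\<rho>\<close> on \<open>W\<close> and \<open>\<sigma>\<close> off \<open>W\<close>, the set \<open>X\<close> collects one arc for each shared
  edge with an end outside \<open>W\<close>.
\<close>
lemma glue:
  assumes W: "W \<subseteq> V" and \<rho>: "\<rho> permutes W" and \<sigma>: "\<sigma> permutes (V - W)" and X: "finite X"
    and cross: "\<And>p v. p \<in> V - W \<Longrightarrow> (p, v) \<in> R \<Longrightarrow> (\<sigma> p, if v \<in> W then \<rho> v else \<sigma> v) \<in> R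
      \<Longrightarrow> (p, v) \<in> X \<or> (v, p) \<in> X"
  shows "\<exists>\<pi>. \<pi> permutes V \<and> card (shared R \<pi>) \<le> card (shared (R \<inter> W \<times> W) \<rho>) + 2 * card X"
proof -
  let ?p = "\<sigma> \<circ> \<rho>"
  have in_W: "?p v = \<rho> v" "\<rho> v \<in> W" if "v \<in> W" for v
  proof -
    show "\<rho> v \<in> W" using \<rho> that by (simp add: permutes_in_image)
    then show "?p v = \<rho> v" using \<sigma> unfolding permutes_def by auto
  qed
  have off_W: "?p v = \<sigma> v" if "v \<notin> W" for v using \<rho> that unfolding permutes_def by auto
  have p: "?p permutes V"
    using \<rho> \<sigma> W by (intro permutes_compose) (auto intro: permutes_subset)
  have sub: "shared R ?p \<subseteq> shared (R \<inter> W \<times> W) \<rho> \<union> (X \<union> X\<inverse>)"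
  proof (rule subrelI)
    fix x y assume "(x, y) \<in> shared R ?p"
    then have xy: "(x, y) \<in> R" "(?p x, ?p y) \<in> R" unfolding shared_def by blast+
    then have V: "x \<in> V" "y \<in> V" by (auto dest: in_V)
    have *: "?p v = (if v \<in> W then \<rho> v else \<sigma> v)" for v using in_W off_W by auto
    show "(x, y) \<in> shared (R \<inter> W \<times> W) \<rho> \<union> (X \<union> X\<inverse>)"
    proof (cases "x \<in> W \<and> y \<in> W")
      case True
      then have "(\<rho> x, \<rho> y) \<in> R" using xy(2) unfolding * by simp
      then show ?thesis using True xy(1) in_W unfolding shared_def by blast
    next
      case False
      have "(x, y) \<in> X \<or> (y, x) \<in> X"
      proof (cases "x \<in> W")
        case True
        then have "y \<in> V - W" using False V by blast
        moreover have "(\<sigma> y, if x \<in> W then \<rho> x else \<sigma> x) \<in> R"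
          using sym[OF xy(2)] calculation unfolding * by (simp split: if_splits)
        ultimately show ?thesis using cross[of y x] sym[OF xy(1)] by blast
      next
        case False
        then have "(\<sigma> x, if y \<in> W then \<rho> y else \<sigma> y) \<in> R"
          using xy(2) unfolding * by (simp split: if_splits)
        then show ?thesis using cross[of x y] xy(1) V False by blast
      qed
      then show ?thesis by blast
    qed
  qed
  have "finite (shared (R \<inter> W \<times> W) \<rho>)"
    by (rule finite_subset[OF _ finite_R]) (auto simp: shared_def)
  then have "card (shared R ?p) \<le> card (shared (R \<inter> W \<times> W) \<rho> \<union> (X \<union> X\<inverse>))"
    using sub X by (intro card_mono) auto
  also have "\<dots> \<le> card (shared (R \<inter> W \<times> W) \<rho>) + (card X + card (X\<inverse>))"
    by (intro order_trans[OF card_Un_le] add_mono order_refl)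
  finally show ?thesis using p by (auto intro!: exI[of _ ?p])
qed

text \<open>
  The shared edges at \<open>u\<close> or \<open>w\<close> are the edge between them, the edges from \<open>w\<close> to its other neighbours,
  which may be mapped to edges at \<open>u\<close>, and the edges from \<open>u\<close> that are mapped to these.
\<close>
lemma swap_two:
  assumes uw: "u \<in> V" "w \<in> V" "u \<noteq> w" and W: "W = V - {u, w}" and \<rho>: "\<rho> permutes W"
  shows "\<exists>\<pi>. \<pi> permutes V \<and> card (shared R \<pi>)
    \<le> card (shared (R \<inter> W \<times> W) \<rho>) + 2 * (card (R `` {w} \<inter> {u}) + 2 * card (R `` {w} - {u}))"
proof -
  let ?N = "R `` {w} - {u}"
  let ?X = "{w} \<times> (R `` {w} \<inter> {u}) \<union> {u} \<times> \<rho> -` ?N \<union> {w} \<times> ?N"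
  have inj: "inj \<rho>" using \<rho> by (rule permutes_inj)
  have fin: "finite ?N" "finite (R `` {w} \<inter> {u})" using finite_nbrs by auto
  have VW: "V - W = {u, w}" using W uw by auto
  have "\<exists>\<pi>. \<pi> permutes V \<and> card (shared R \<pi>) \<le> card (shared (R \<inter> W \<times> W) \<rho>) + 2 * card ?X"
  proof (rule glue[OF _ \<rho>, where \<sigma> = "transpose u w"])
    show "transpose u w permutes (V - W)" unfolding VW by (rule permutes_swap_id) auto
    show "finite ?X" using fin inj by (intro finite_UnI finite_cartesian_product finite_vimageI) auto
    fix p v assume pv: "p \<in> V - W" "(p, v) \<in> R" "(transpose u w p, if v \<in> W then \<rho> v else transpose u w v) \<in> R"
    have "v \<in> W \<or> v = u \<or> v = w" using pv(2) W by (auto dest: in_V)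
    have rv: "\<rho> v \<in> W" if "v \<in> W" using \<rho> that by (simp add: permutes_in_image)
    show "(p, v) \<in> ?X \<or> (v, p) \<in> ?X"
    proof (cases "p = w")
      case True
      then show ?thesis using pv(2) by auto
    next
      case False
      then have p: "p = u" using pv(1) VW by auto
      show ?thesis
      proof (cases "v \<in> W")
        case True
        then show ?thesis using pv p rv W by auto
      next
        case False
        then have "v = w" using pv(2) p irrefl W by (auto dest: in_V)
        then show ?thesis using p sym[OF pv(2)] by auto
      qed
    qed
  qed (use W in auto)
  moreover have "card ?X \<le> card (R `` {w} \<inter> {u}) + 2 * card ?N"
  proof -
    have "card (\<rho> -` ?N) = card ?N" using \<rho> by (metis card_vimage_inj permutes_inj permutes_surj subset_UNIV)
    moreover have "card ?X \<le> card ({w} \<times> (R `` {w} \<inter> {u})) + card ({u} \<times> \<rho> -` ?N) + card ({w} \<times> ?N)"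
      by (intro order_trans[OF card_Un_le] add_mono order_refl)
    ultimately show ?thesis by (simp add: card_cartesian_product)
  qed
  ultimately show ?thesis by (smt (verit) add_left_mono le_trans mult_le_mono2)
qed

text \<open>
  All neighbours of \<open>z1\<close> and \<open>z2\<close> are exchanged with \<open>z1\<close> and \<open>z2\<close>, so only the four edges between
  \<open>{u1, u2}\<close> and \<open>{z1, z2}\<close> can be shared.
\<close>
lemma swap_two_pairs:
  assumes uz: "u1 \<in> V" "u2 \<in> V" "z1 \<in> V" "z2 \<in> V" "distinct [u1, u2, z1, z2]"
    and N: "R `` {z1} \<subseteq> {u1, u2}" "R `` {z2} \<subseteq> {u1, u2}"
    and W: "W = V - {u1, u2, z1, z2}" and \<rho>: "\<rho> permutes W"
  shows "\<exists>\<pi>. \<pi> permutes V \<and> card (shared R \<pi>) \<le> card (shared (R \<inter> W \<times> W) \<rho>) + 8"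
proof -
  let ?X = "{u1, u2} \<times> {z1, z2}"
  let ?s = "transpose u1 z1 \<circ> transpose u2 z2"
  have VW: "V - W = {u1, u2, z1, z2}" using W uz by auto
  have s: "?s u1 = z1" "?s z1 = u1" "?s u2 = z2" "?s z2 = u2"
    using uz(5) by (auto simp: transpose_def)
  have "\<exists>\<pi>. \<pi> permutes V \<and> card (shared R \<pi>) \<le> card (shared (R \<inter> W \<times> W) \<rho>) + 2 * card ?X"
  proof (rule glue[OF _ \<rho>, where \<sigma> = ?s])
    show "?s permutes (V - W)" unfolding VW by (intro permutes_compose permutes_swap_id) auto
    fix p v assume pv: "p \<in> V - W" "(p, v) \<in> R" "(?s p, if v \<in> W then \<rho> v else ?s v) \<in> R"
    have v: "v \<in> W \<or> v \<in> {u1, u2, z1, z2}" using pv(2) W by (auto dest: in_V)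
    have rv: "\<rho> v \<in> W" if "v \<in> W" using \<rho> that by (simp add: permutes_in_image)
    show "(p, v) \<in> ?X \<or> (v, p) \<in> ?X"
    proof (cases "p \<in> {z1, z2}")
      case True
      then show ?thesis using pv(2) N by auto
    next
      case False
      then have p: "p \<in> {u1, u2}" using pv(1) VW by auto
      then have "?s p \<in> {z1, z2}" using s by auto
      then have "(if v \<in> W then \<rho> v else ?s v) \<in> {u1, u2}" using pv(3) N by auto
      then have "v \<in> {z1, z2}" using v rv W uz(5) s by (auto split: if_splits)
      then show ?thesis using p by auto
    qed
  qed (use W in auto)
  moreover have "card ?X = 4" using uz(5) by (simp add: card_cartesian_product)
  ultimately show ?thesis by simp
qed

text \<open>
  The permutation exchanges \<open>u\<close> with \<open>w\<close>, and \<open>y\<close> with \<open>z\<close>. Compared with exchanging only \<open>u\<close> and \<open>w\<close>,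
  the two edges at \<open>u\<close> and \<open>w\<close> that involve \<open>y\<close> are no longer shared: the edge from \<open>w\<close> to \<open>y\<close> would
  have to be mapped to an edge from \<open>u\<close> to \<open>z\<close>, and an edge from \<open>u\<close> to \<open>z\<close> to the one from \<open>w\<close> to \<open>y\<close>.
  The price is that edges at \<open>y\<close> and \<open>z\<close> may be shared. Apart from \<open>u\<close> and \<open>w\<close>, which are not adjacent
  to \<open>z\<close>, the vertex \<open>y\<close> has only the neighbour \<open>q\<close>, so it suffices that \<open>\<rho>\<close> does not map
  \<open>q\<close> to a neighbour of \<open>z\<close> or conversely.
\<close>
lemma swap_hub_and_neighbour:
  assumes V: "u \<in> V" "w \<in> V" "y \<in> V" "z \<in> V" and ne: "u \<noteq> z" "w \<noteq> z" "y \<noteq> z"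
    and Nw: "R `` {w} - {u} = {y, x}" and Ny: "R `` {y} - {u} = {w, q}" and Nz: "R `` {z} \<inter> {u, w, y} = {}"
    and wu: "w \<noteq> u" "y \<noteq> u" and W: "W = V - {u, w, y, z}" and \<rho>: "\<rho> permutes W"
    and T: "\<And>v. v \<in> insert q (R `` {z}) \<Longrightarrow> \<rho> v \<notin> insert q (R `` {z})"
  shows "\<exists>\<pi>. \<pi> permutes V \<and> card (shared R \<pi>) \<le> card (shared (R \<inter> W \<times> W) \<rho>) + 6"
proof -
  let ?X = "{(u, w), (w, x), (u, inv \<rho> x)}"
  let ?s = "transpose u w \<circ> transpose y z"
  have wy: "(w, y) \<in> R" "(w, x) \<in> R" "(y, q) \<in> R" "x \<noteq> u" "q \<noteq> u" using Nw Ny by auto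
  have nz: "(z, u) \<notin> R" "(z, w) \<notin> R" "(z, y) \<notin> R" using Nz by auto
  have d: "distinct [u, w, y, z]" using ne wu wy irrefl by auto
  have VW: "V - W = {u, w, y, z}" using W V by auto
  have s: "?s u = w" "?s w = u" "?s y = z" "?s z = y" using d by (auto simp: transpose_def)
  have xq: "x \<noteq> w" "x \<noteq> z" "q \<noteq> y" "q \<noteq> z" using wy irrefl nz sym by blast+
  have rv: "\<rho> v \<in> W" if "v \<in> W" for v using \<rho> that by (simp add: permutes_in_image)
  have "\<exists>\<pi>. \<pi> permutes V \<and> card (shared R \<pi>) \<le> card (shared (R \<inter> W \<times> W) \<rho>) + 2 * card ?X"
  proof (rule glue[OF _ \<rho>, where \<sigma> = ?s])
    show "?s permutes (V - W)" unfolding VW by (intro permutes_compose permutes_swap_id) auto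
    fix p v assume pv: "p \<in> V - W" "(p, v) \<in> R" "(?s p, if v \<in> W then \<rho> v else ?s v) \<in> R"
    define v' where "v' = (if v \<in> W then \<rho> v else ?s v)"
    have pv': "(?s p, v') \<in> R" using pv(3) unfolding v'_def .
    have v: "v \<in> W \<or> v \<in> {u, w, y, z}" using pv(2) W by (auto dest: in_V)
    have v'W: "v' \<in> W" "v' = \<rho> v" if "v \<in> W" using that rv unfolding v'_def by auto
    have v's: "v' = ?s v" if "v \<in> {u, w, y, z}" using that VW unfolding v'_def by auto
    have v'o: "v = w" if "v' = u" using that v v'W v's s d W by auto
    have v'z: "v = z" if "v' = y" using that v v'W v's s d W by auto
    consider "p = u" | "p = w" | "p = y" | "p = z" using pv(1) VW by auto
    then show "(p, v) \<in> ?X \<or> (v, p) \<in> ?X"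
    proof cases
      case 1
      then have "v' \<in> {u, y, x}" using pv' s Nw by auto
      moreover have "v \<noteq> z" using pv(2) 1 nz sym by blast
      moreover have "v = inv \<rho> x" if "v' = x" "v \<in> W"
        using v'W that permutes_inverses(2)[OF \<rho>] by metis
      moreover have "v \<in> {u, w, y, z} \<Longrightarrow> v' = x \<Longrightarrow> v = w \<or> x = y"
        using v's s xq wy pv(2) 1 nz irrefl by auto
      ultimately show ?thesis using v v'o v'z 1 by auto
    next
      case 2
      then have "v \<in> {u, y, x}" using pv(2) Nw by auto
      moreover have "v \<noteq> y" using v's s pv' 2 nz sym by force
      ultimately show ?thesis using 2 by auto
    next
      case 3
      then have "v \<in> {u, w, q}" using pv(2) Ny by auto
      moreover have "v \<noteq> u"
      proof
        assume "v = u"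
        then have "v' = w" using v's s(1) by simp
        then show False using pv' 3 s(3) nz(2) by simp
      qed
      moreover have "v \<noteq> w"
      proof
        assume "v = w"
        then have "v' = u" using v's s(2) by simp
        then show False using pv' 3 s(3) nz(1) by simp
      qed
      ultimately have "v = q" "v \<notin> {u, w}" by auto
      then have "\<rho> q \<in> R `` {z}" using 3 v VW xq pv' s v'W v's wy by auto
      then show ?thesis using T[of q] by auto
    next
      case 4
      then have vz: "v \<in> R `` {z}" using pv(2) by auto
      then have "v \<in> W" using v nz irrefl by auto
      moreover have "v' \<in> {u, w, q}" using pv' s 4 Ny by auto
      ultimately have "\<rho> v = q" using v'W W by auto
      then show ?thesis using T[of v] vz by auto
    qed
  qed (use W in auto)
  then obtain \<pi> where \<pi>: "\<pi> permutes V" "card (shared R \<pi>) \<le> card (shared (R \<inter> W \<times> W) \<rho>) + 2 * card ?X"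
    by blast
  moreover have "card ?X \<le> 3" using card_length[of "[(u, w), (w, x), (u, inv \<rho> x)]"] by simp
  ultimately show ?thesis by (intro exI[of _ \<pi>]) linarith
qed

end

section \<open>Graphs with vertices adjacent to nearly all others\<close>

context sym_arcs
begin

lemma deg_le_card: "deg R v \<le> card R"
proof -
  have "R `` {v} \<subseteq> snd ` R" by force
  then have "card (R `` {v}) \<le> card (snd ` R)" using finite_R by (intro card_mono) auto
  then show ?thesis unfolding deg_def using card_image_le[OF finite_R, of snd] by linarith
qed

lemma deg_restrict: "deg (R \<inter> W \<times> W) v \<le> deg R v"
  unfolding deg_def by (intro card_mono finite_nbrs) auto

text \<open>
  The degrees of the two vertices add up to more than \<open>1.85 * card V\<close>, so most other vertices have no neighbours
  besides them.
\<close>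
lemma arcs_two_hubs:
  assumes n: "10 ^ 20 + 4 \<le> card V" and R: "card R + 6 \<le> 4 * card V"
    and u: "u1 \<in> V" "u2 \<in> V" "u1 \<noteq> u2" "19 * card V < 20 * deg R u1" "9 * card V < 10 * deg R u2"
  shows "\<exists>\<pi>. \<pi> permutes V \<and> card (shared R \<pi>) < 10"
proof -
  let ?U = "{u1, u2}"
  let ?H = "V - ?U"
  let ?RH = "R \<inter> ?H \<times> ?H"
  have "card (R \<inter> ?U \<times> UNIV) = deg R u1 + deg R u2"
    using card_arcs_from[of ?U] u by simp
  moreover have "card (R \<inter> ?U \<times> ?U) \<le> 2"
  proof -
    have "card (R \<inter> ?U \<times> ?U) \<le> card (set [(u1, u2), (u2, u1)])"
      using irrefl by (intro card_mono) auto
    also have "\<dots> \<le> 2" using card_length[of "[(u1, u2), (u2, u1)]"] by simp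
    finally show ?thesis .
  qed
  ultimately have RH: "10 * card ?RH \<le> 3 * card V"
    using card_arcs_outside[of ?U] u R by auto
  define Z where "Z = {z \<in> ?H. R `` {z} \<subseteq> ?U}"
  have "?H - Z \<subseteq> fst ` ?RH"
  proof
    fix v assume "v \<in> ?H - Z"
    then obtain x where "v \<in> ?H" "(v, x) \<in> R" "x \<notin> ?U" unfolding Z_def by auto
    then have "(v, x) \<in> ?RH" by (auto dest: in_V)
    then show "v \<in> fst ` ?RH" by force
  qed
  then have "card (?H - Z) \<le> card (fst ` ?RH)" using finite_R by (intro card_mono) auto
  also have "\<dots> \<le> card ?RH" using finite_R by (intro card_image_le) auto
  finally have "card (?H - Z) \<le> card ?RH" .
  moreover have "card (?H - Z) = card ?H - card Z"
    using finite_V by (intro card_Diff_subset) (auto simp: Z_def)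
  moreover have "card ?H = card V - 2" using u finite_V by (simp add: card_Diff_subset)
  ultimately have "2 \<le> card Z" using RH n by simp
  then obtain Y where "Y \<subseteq> Z" "card Y = 2" using obtain_subset_with_card_n by metis
  then obtain z1 z2 where z: "z1 \<in> Z" "z2 \<in> Z" "z1 \<noteq> z2" by (auto simp: card_2_iff)
  have d: "distinct [u1, u2, z1, z2]" using u z unfolding Z_def by auto
  define W where "W = V - {u1, u2, z1, z2}"
  have cW: "card W = card V - 4"
    unfolding W_def using u z d finite_V by (subst card_Diff_subset) (auto simp: Z_def)
  interpret W: sym_arcs W "R \<inter> W \<times> W" by (rule restrict) (auto simp: W_def)
  have RW: "card (R \<inter> W \<times> W) \<le> card ?RH" using finite_R by (intro card_mono) (auto simp: W_def)
  have nW: "10 ^ 20 \<le> card W" "card (R \<inter> W \<times> W) \<le> 4 * card W"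
    using RW RH cW n by simp_all
  have "\<exists>\<rho>. \<rho> permutes W \<and> (\<forall>s\<in>{}. \<rho> s \<notin> {}) \<and> card (shared (R \<inter> W \<times> W) \<rho>) < 2 * 0 + 2"
  proof (rule W.packing_around[OF nW, where c = 4])
    show "10 * card (R \<inter> W \<times> W \<inter> S \<times> UNIV) \<le> 4 * card W" for S
    proof -
      have "card (R \<inter> W \<times> W \<inter> S \<times> UNIV) \<le> card (R \<inter> W \<times> W)"
        using W.finite_R by (intro card_mono) auto
      then show ?thesis using RW RH cW n by simp
    qed
    show "20 * deg (R \<inter> W \<times> W) v \<le> 19 * card W" for v
      using W.deg_le_card[of v] RW RH cW n by simp
  qed simp_all
  then obtain \<rho> where \<rho>: "\<rho> permutes W" "card (shared (R \<inter> W \<times> W) \<rho>) < 2" by auto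
  have "z1 \<in> V" "z2 \<in> V" "R `` {z1} \<subseteq> ?U" "R `` {z2} \<subseteq> ?U" using z unfolding Z_def by auto
  from swap_two_pairs[OF u(1,2) this(1,2) d this(3,4) W_def \<rho>(1)]
  obtain \<pi> where "\<pi> permutes V" "card (shared R \<pi>) \<le> card (shared (R \<inter> W \<times> W) \<rho>) + 8"
    by blast
  then show ?thesis using \<rho>(2) by (intro exI[of _ \<pi>]) linarith
qed

text \<open>
  Let \<open>M\<close> be the set of vertices of \<open>H\<close> that are not adjacent to \<open>u\<close>. If all degrees in \<open>H\<close> are at
  least two, then the bound on the number of arcs says that the excess of the degrees over two adds up
  to at most \<open>2 * card M - 2\<close> (\<open>exH\<close>). In particular not all vertices of \<open>M\<close> have excess two or more,
  and \<open>M\<close> has at most \<open>card V / 20\<close> elements. Hence nearly all vertices have degree two in \<open>H\<close>, and even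
  after removal of the exceptional set \<open>B\<close> there are two adjacent vertices \<open>w\<close> and \<open>y\<close> of degree two.
\<close>
lemma arcs_one_hub:
  assumes n: "10 ^ 20 + 4 \<le> card V" and R: "card R + 6 \<le> 4 * card V"
    and u: "u \<in> V" "19 * card V < 20 * deg R u"
    and rest: "\<And>v. v \<in> V - {u} \<Longrightarrow> 10 * deg R v \<le> 9 * card V"
  shows "\<exists>\<pi>. \<pi> permutes V \<and> card (shared R \<pi>) < 10"
proof -
  define H where "H = V - {u}"
  let ?RH = "R \<inter> H \<times> H"
  interpret H: sym_arcs H ?RH by (rule restrict) (auto simp: H_def)
  have cH: "card H + 1 = card V" unfolding H_def using card_Suc_Diff1[OF finite_V u(1)] by simp
  have "R \<inter> {u} \<times> {u} = {}" using irrefl by auto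
  then have RH: "card ?RH + 2 * deg R u = card R"
    using card_arcs_outside[of "{u}"] card_arcs_from[of "{u}"] u unfolding H_def by simp
  have nbrs: "?RH `` {v} = R `` {v} - {u}" if "v \<in> H" for v
    using that unfolding H_def by (auto dest: in_V)
  have degH: "deg ?RH v = card (R `` {v} - {u})" if "v \<in> H" for v
    unfolding deg_def nbrs[OF that] ..
  have swap: "\<exists>\<pi>. \<pi> permutes V \<and> card (shared R \<pi>) < 2 * k + 2 + 2 * (card (R `` {w} \<inter> {u}) + 2 * deg ?RH w)"
    if w: "w \<in> H" and k: "k \<le> 4" "2 * c ^ 2 \<le> 100 * (2 * k + 1)"
      and A: "\<And>S. S \<subseteq> H \<Longrightarrow> card S \<le> 10 ^ 7 \<Longrightarrow> 10 * card (?RH \<inter> S \<times> UNIV) \<le> c * (card V - 4)"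
    for w k c
  proof -
    define W where "W = V - {u, w}"
    have WH: "W \<subseteq> H" unfolding W_def H_def by auto
    have cW: "card W = card V - 2"
      unfolding W_def using u w finite_V by (subst card_Diff_subset) (auto simp: H_def)
    interpret W: sym_arcs W "R \<inter> W \<times> W" by (rule restrict) (auto simp: W_def)
    have "card (R \<inter> W \<times> W) \<le> card ?RH" using WH finite_R by (intro card_mono) auto
    then have nW: "10 ^ 20 \<le> card W" "card (R \<inter> W \<times> W) \<le> 4 * card W"
      using RH R u cW n by simp_all
    have "\<exists>\<rho>. \<rho> permutes W \<and> (\<forall>s\<in>{}. \<rho> s \<notin> {}) \<and> card (shared (R \<inter> W \<times> W) \<rho>) < 2 * k + 2"
    proof (rule W.packing_around[OF nW k(1) _ _ _ _ k(2)])
      fix S assume S: "S \<subseteq> W" "card S \<le> 10 ^ 7"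
      have "card (R \<inter> W \<times> W \<inter> S \<times> UNIV) \<le> card (?RH \<inter> S \<times> UNIV)"
        using WH finite_R by (intro card_mono) auto
      also have "10 * \<dots> \<le> c * (card V - 4)" using S WH by (intro A) auto
      also have "\<dots> \<le> c * card W" using cW by (intro mult_le_mono) auto
      finally show "10 * card (R \<inter> W \<times> W \<inter> S \<times> UNIV) \<le> c * card W" by simp
    next
      fix v assume "v \<in> W"
      then have "10 * deg R v \<le> 9 * card V" using rest WH unfolding H_def by auto
      then show "20 * deg (R \<inter> W \<times> W) v \<le> 19 * card W" using deg_restrict[of W v] cW n by simp
    qed simp_all
    then obtain \<rho> where \<rho>: "\<rho> permutes W" "card (shared (R \<inter> W \<times> W) \<rho>) < 2 * k + 2" by auto
    have "w \<in> V" "u \<noteq> w" using w unfolding H_def by auto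
    then obtain \<pi> where "\<pi> permutes V" "card (shared R \<pi>) \<le> card (shared (R \<inter> W \<times> W) \<rho>)
        + 2 * (card (R `` {w} \<inter> {u}) + 2 * deg ?RH w)"
      using swap_two[OF u(1) _ _ W_def \<rho>(1)] degH[OF w] by auto
    then show ?thesis using \<rho>(2) by (intro exI[of _ \<pi>]) linarith
  qed
  show ?thesis
  proof (cases "\<exists>w\<in>H. deg ?RH w \<le> 1")
    case True
    then obtain w where w: "w \<in> H" "deg ?RH w \<le> 1" by blast
    \<comment> \<open>Without u there are at most about 2.1 n arcs, and about half of them can start in S. The
      resulting bound 1.1 n is good enough for k = 1.\<close>
    have "10 * card (?RH \<inter> S \<times> UNIV) \<le> 11 * (card V - 4)" if "S \<subseteq> H" "card S \<le> 10 ^ 7" for S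
    proof -
      have "card S ^ 2 \<le> (10 ^ 7) ^ 2" using that by (intro power_mono) auto
      then show ?thesis using H.card_arcs_from_le[OF that(1)] RH R u n by simp
    qed
    from swap[OF w(1) _ _ this, of 1] obtain \<pi> where "\<pi> permutes V"
      "card (shared R \<pi>) < 4 + 2 * (card (R `` {w} \<inter> {u}) + 2 * deg ?RH w)" by auto
    moreover have "card (R `` {w} \<inter> {u}) \<le> card {u}" by (intro card_mono) auto
    ultimately show ?thesis using w by (intro exI[of _ \<pi>]) simp
  next
    case False
    then have two: "2 \<le> deg ?RH v" if "v \<in> H" for v using that by force
    define ex where "ex v = deg ?RH v - 2" for v
    have ex: "deg ?RH v = ex v + 2" if "v \<in> H" for v using two[OF that] unfolding ex_def by simp
    have sum_ex: "(\<Sum>v\<in>S. deg ?RH v) = (\<Sum>v\<in>S. ex v) + 2 * card S" if "S \<subseteq> H" for S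
    proof -
      have "(\<Sum>v\<in>S. deg ?RH v) = (\<Sum>v\<in>S. ex v + 2)" using that ex by (intro sum.cong) auto
      then show ?thesis unfolding sum.distrib by simp
    qed
    define M where "M = H - R `` {u}"
    have M: "card M + deg R u = card H"
    proof -
      have "R `` {u} \<subseteq> H" using irrefl in_V unfolding H_def by auto
      then show ?thesis unfolding M_def deg_def
        using card_Diff_subset[of "R `` {u}" H] finite_nbrs card_mono[OF H.finite_V] by simp
    qed
    have exH: "(\<Sum>v\<in>H. ex v) + 2 \<le> 2 * card M"
      using sum_ex[OF order_refl] H.sum_deg RH R M cH by linarith
    have ex_le: "(\<Sum>v\<in>S. ex v) + 2 \<le> 2 * card M" if "S \<subseteq> H" for S
      using sum_mono2[OF H.finite_V that, of ex] exH by simp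
    have M_small: "20 * card M \<le> card V" using M cH u by linarith
    \<comment> \<open>The degrees in S add up to their total excess and twice the size of S, which is small enough
      for k = 0.\<close>
    have A: "10 * card (?RH \<inter> S \<times> UNIV) \<le> 2 * (card V - 4)" if "S \<subseteq> H" "card S \<le> 10 ^ 7" for S
      using H.card_arcs_from[of S] finite_subset[OF that(1) H.finite_V] sum_ex[OF that(1)]
        ex_le[OF that(1)] that(2) M_small n by simp
    show ?thesis
    proof (cases "\<exists>z\<in>M. deg ?RH z = 2")
      case True
      then obtain z where z: "z \<in> H" "(u, z) \<notin> R" "deg ?RH z = 2" unfolding M_def by auto
      from swap[OF z(1) _ _ A, of 0] obtain \<pi> where "\<pi> permutes V"
        "card (shared R \<pi>) < 2 + 2 * (card (R `` {z} \<inter> {u}) + 2 * deg ?RH z)" by auto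
      moreover have "R `` {z} \<inter> {u} = {}" using z(2) sym by auto
      ultimately show ?thesis using z(3) by (intro exI[of _ \<pi>]) simp
    next
      case False
      have "\<exists>z\<in>M. ex z < 2"
      proof (rule ccontr)
        assume "\<not> (\<exists>z\<in>M. ex z < 2)"
        then have "(\<Sum>z\<in>M. 2) \<le> (\<Sum>z\<in>M. ex z)" by (intro sum_mono) (auto simp: not_less)
        then show False using ex_le[of M] unfolding M_def by simp
      qed
      then obtain z where z: "z \<in> M" "ex z < 2" by blast
      then have zH: "z \<in> H" "(z, u) \<notin> R" unfolding M_def by (auto dest: sym)
      have z3: "deg ?RH z = 3" using False z ex[OF zH(1)] by force
      have Nz: "R `` {z} \<subseteq> H" "card (R `` {z}) = 3"
        using z3 degH[OF zH(1)] zH unfolding H_def by (auto dest: in_V)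
      define B where "B = R `` {z} \<union> {v \<in> H. ex v \<noteq> 0}"
      have BH: "B \<subseteq> H" unfolding B_def using Nz by auto
      have "card {v \<in> H. ex v \<noteq> 0} = (\<Sum>v\<in>{v \<in> H. ex v \<noteq> 0}. 1)" by simp
      also have "\<dots> \<le> (\<Sum>v\<in>{v \<in> H. ex v \<noteq> 0}. ex v)" by (intro sum_mono) auto
      finally have "card {v \<in> H. ex v \<noteq> 0} + 2 \<le> 2 * card M"
        using ex_le[of "{v \<in> H. ex v \<noteq> 0}"] by auto
      then have cB: "card B \<le> 1 + 2 * card M"
        using card_Un_le[of "R `` {z}" "{v \<in> H. ex v \<noteq> 0}"] Nz unfolding B_def by linarith
      have good: "deg ?RH v = 2" if "v \<in> H - B" for v using that ex unfolding B_def by auto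
      have "\<exists>w\<in>H - B. \<exists>y\<in>H - B. (w, y) \<in> R"
      proof (rule ccontr)
        assume no: "\<not> (\<exists>w\<in>H - B. \<exists>y\<in>H - B. (w, y) \<in> R)"
        have finG: "finite (H - B)" using H.finite_V by auto
        have "2 * card (H - B) = (\<Sum>v\<in>H - B. deg ?RH v)" using good by simp
        also have "\<dots> = card (?RH \<inter> (H - B) \<times> UNIV)" using H.card_arcs_from[OF finG] by simp
        also have "\<dots> \<le> card (?RH \<inter> UNIV \<times> B)"
          using no H.finite_R by (intro card_mono) auto
        also have "\<dots> = (\<Sum>v\<in>B. deg ?RH v)"
          using H.card_arcs_into[of B] H.card_arcs_from[of B] finite_subset[OF BH H.finite_V] by simp
        also have "\<dots> = (\<Sum>v\<in>B. ex v) + 2 * card B" by (rule sum_ex[OF BH])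
        finally have "2 * card (H - B) + 2 \<le> 2 * card M + 2 * card B" using ex_le[OF BH] by simp
        moreover have "card (H - B) = card H - card B"
          using BH H.finite_V by (intro card_Diff_subset) (auto intro: finite_subset)
        ultimately show False using cB M_small cH n by simp
      qed
      then obtain w y where wy: "w \<in> H - B" "y \<in> H - B" "(w, y) \<in> R" by blast
      have "card (R `` {w} - {u}) = 2" "y \<in> R `` {w} - {u}"
        using good[OF wy(1)] degH wy unfolding H_def by auto
      then obtain x where Nw: "R `` {w} - {u} = {y, x}" by (metis card_2_iff doubleton_eq_iff insertE singletonD)
      have "card (R `` {y} - {u}) = 2" "w \<in> R `` {y} - {u}"
        using good[OF wy(2)] degH wy sym unfolding H_def by auto
      then obtain q where Ny: "R `` {y} - {u} = {w, q}" by (metis card_2_iff doubleton_eq_iff insertE singletonD)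
      have ne: "u \<noteq> z" "w \<noteq> z" "y \<noteq> z" "w \<noteq> u" "y \<noteq> u"
        using wy zH good[OF wy(1)] good[OF wy(2)] z3 unfolding H_def by auto
      have Nz': "R `` {z} \<inter> {u, w, y} = {}" using wy zH unfolding B_def by auto
      have inV: "w \<in> V" "y \<in> V" "z \<in> V" using wy zH unfolding H_def by auto
      have "w \<noteq> y" using wy(3) irrefl by auto
      define W where "W = V - {u, w, y, z}"
      have WH: "W \<subseteq> H" unfolding W_def H_def by auto
      have cW: "card W = card V - 4"
        unfolding W_def using u inV ne \<open>w \<noteq> y\<close> finite_V by (subst card_Diff_subset) auto
      interpret W: sym_arcs W "R \<inter> W \<times> W" by (rule restrict) (auto simp: W_def)
      have q: "(y, q) \<in> R" "q \<noteq> u" using Ny by auto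
      have "q \<noteq> y" "q \<noteq> z" "q \<in> V" using q Nz' irrefl sym in_V by blast+
      then have "q \<in> W \<or> q = w" using q unfolding W_def by auto
      moreover have "q \<noteq> w"
        using \<open>card (R `` {y} - {u}) = 2\<close> unfolding Ny by (auto simp: card_insert_if split: if_splits)
      ultimately have T: "insert q (R `` {z}) \<subseteq> W"
        using Nz' irrefl unfolding W_def by (auto dest: in_V)
      let ?T = "insert q (R `` {z})"
      have "card (R \<inter> W \<times> W) \<le> card ?RH" using WH finite_R by (intro card_mono) auto
      then have nW: "10 ^ 20 \<le> card W" "card (R \<inter> W \<times> W) \<le> 4 * card W"
        using RH R u cW n by simp_all
      have "\<exists>\<rho>. \<rho> permutes W \<and> (\<forall>s\<in>?T. \<rho> s \<notin> ?T) \<and> card (shared (R \<inter> W \<times> W) \<rho>) < 2 * 0 + 2"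
      proof (rule W.packing_around[OF nW, where c = 2])
        show "?T \<subseteq> W" by (rule T)
        show "card ?T \<le> 4" using Nz finite_nbrs by (simp add: card_insert_if)
        fix S assume S: "S \<subseteq> W" "card S \<le> 10 ^ 7"
        have "card (R \<inter> W \<times> W \<inter> S \<times> UNIV) \<le> card (?RH \<inter> S \<times> UNIV)"
          using WH finite_R by (intro card_mono) auto
        also have "10 * \<dots> \<le> 2 * (card V - 4)" using S WH by (intro A) auto
        finally show "10 * card (R \<inter> W \<times> W \<inter> S \<times> UNIV) \<le> 2 * card W" using cW by simp
      next
        fix v assume "v \<in> W"
        then have "10 * deg R v \<le> 9 * card V" using rest WH unfolding H_def by auto
        then show "20 * deg (R \<inter> W \<times> W) v \<le> 19 * card W" using deg_restrict[of W v] cW n by simp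
      qed simp_all
      then obtain \<rho> where \<rho>: "\<rho> permutes W" "\<And>s. s \<in> ?T \<Longrightarrow> \<rho> s \<notin> ?T"
        "card (shared (R \<inter> W \<times> W) \<rho>) < 2"
        unfolding mult_0_right add_0 by blast
      obtain \<pi> where "\<pi> permutes V" "card (shared R \<pi>) \<le> card (shared (R \<inter> W \<times> W) \<rho>) + 6"
        using swap_hub_and_neighbour[OF u(1) inV ne(1-3) Nw Ny Nz' ne(4,5) W_def \<rho>(1,2)]
        by blast
      then show ?thesis using \<rho>(3) by (intro exI[of _ \<pi>]) linarith
    qed
  qed
qed

text \<open>
  If no vertex is adjacent to nearly all others, \<open>packing\<close> applies directly: at most about
  \<open>2 * card V\<close> arcs start in \<open>S\<close>, which allows \<open>k = 4\<close>.
\<close>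
lemma few_shared_arcs:
  assumes n: "10 ^ 20 + 4 \<le> card V" and R: "card R + 6 \<le> 4 * card V"
  shows "\<exists>\<pi>. \<pi> permutes V \<and> card (shared R \<pi>) < 10"
proof (cases "\<exists>u\<in>V. 19 * card V < 20 * deg R u")
  case True
  then obtain u where u: "u \<in> V" "19 * card V < 20 * deg R u" by blast
  show ?thesis
  proof (cases "\<exists>v\<in>V - {u}. 9 * card V < 10 * deg R v")
    case True
    then show ?thesis using arcs_two_hubs[OF n R u(1) _ _ u(2)] by blast
  next
    case False
    then show ?thesis using arcs_one_hub[OF n R u] by (meson not_less)
  qed
next
  case False
  have nV: "10 ^ 20 \<le> card V" "card R \<le> 4 * card V" using n R by simp_all
  have "\<exists>\<pi>. \<pi> permutes V \<and> (\<forall>s\<in>{}. \<pi> s \<notin> {}) \<and> card (shared R \<pi>) < 2 * 4 + 2"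
  proof (rule packing_around[OF nV, where c = 21])
    fix S assume S: "S \<subseteq> V" "card S \<le> 10 ^ 7"
    have "card S ^ 2 \<le> (10 ^ 7) ^ 2" using S by (intro power_mono) auto
    \<comment> \<open>The constant 21 instead of 20 leaves room for the arcs inside S.\<close>
    then show "10 * card (R \<inter> S \<times> UNIV) \<le> 21 * card V"
      using card_arcs_from_le[OF S(1)] R n by simp
  qed (use False in \<open>simp_all add: not_less\<close>)
  then show ?thesis by auto
qed

end

section \<open>Edges, wheels and the extremal number\<close>

definition arcs :: "'a set set \<Rightarrow> ('a \<times> 'a) set" where
  "arcs E = {(x, y). {x, y} \<in> E}"

lemma card_arcs:
  assumes "finite F" "\<And>e. e \<in> F \<Longrightarrow> card e = 2"
  shows "card (arcs F) = 2 * card F"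
proof -
  have two: "finite {(x, y). {x, y} = e} \<and> card {(x, y). {x, y} = e} = 2" if e: "e \<in> F" for e
  proof -
    obtain a b where ab: "e = {a, b}" "a \<noteq> b" using assms(2)[OF e] by (auto simp: card_2_iff)
    then have "{(x, y). {x, y} = e} = {(a, b), (b, a)}" by (auto simp: doubleton_eq_iff)
    then show ?thesis using ab by simp
  qed
  have "card (arcs F) = card (\<Union>e\<in>F. {(x, y). {x, y} = e})" unfolding arcs_def by (rule arg_cong[where f = card]) auto
  also have "\<dots> = (\<Sum>e\<in>F. card {(x, y). {x, y} = e})"
    using assms(1) two by (intro card_UN_disjoint) auto
  also have "\<dots> = 2 * card F" using two by simp
  finally show ?thesis .
qed

lemma sym_arcs_arcs: "simple_graph V E \<Longrightarrow> sym_arcs V (arcs E)"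
  unfolding simple_graph_def arcs_def by unfold_locales (auto simp: insert_commute)

lemma finite_simple_graph: "simple_graph V E \<Longrightarrow> finite E"
  unfolding simple_graph_def by (metis Pow_iff finite_Pow_iff finite_subset subsetI)

lemma card_shared_arcs:
  assumes G: "simple_graph V E" and \<pi>: "\<pi> permutes V"
  shows "card (shared (arcs E) \<pi>) = 2 * edge_intersection E \<pi>"
proof -
  have inj: "inj \<pi>" using \<pi> by (rule permutes_inj)
  let ?F = "E \<inter> permuted_edges \<pi> E"
  have "arcs ?F = map_prod \<pi> \<pi> ` shared (arcs E) \<pi>"
  proof (intro subset_antisym subrelI)
    fix x' y' assume "(x', y') \<in> arcs ?F"
    then obtain x y where xy: "{x', y'} \<in> E" "{x', y'} = {\<pi> x, \<pi> y}" "{x, y} \<in> E"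
      unfolding arcs_def permuted_edges_def by auto
    then have "(x', y') = (\<pi> x, \<pi> y) \<or> (x', y') = (\<pi> y, \<pi> x)" by (auto simp: doubleton_eq_iff)
    moreover have "(x, y) \<in> shared (arcs E) \<pi>" "(y, x) \<in> shared (arcs E) \<pi>"
      using xy unfolding shared_def arcs_def by (auto simp: insert_commute)
    ultimately show "(x', y') \<in> map_prod \<pi> \<pi> ` shared (arcs E) \<pi>" by force
  next
    fix x' y' assume "(x', y') \<in> map_prod \<pi> \<pi> ` shared (arcs E) \<pi>"
    then show "(x', y') \<in> arcs ?F" unfolding shared_def arcs_def permuted_edges_def by auto
  qed
  moreover have "inj_on (map_prod \<pi> \<pi>) (shared (arcs E) \<pi>)"
    using inj by (auto intro: inj_onI simp: inj_eq)
  ultimately have "card (shared (arcs E) \<pi>) = card (arcs ?F)" by (simp add: card_image)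
  also have "\<dots> = 2 * card ?F"
    using G finite_simple_graph[OF G] by (intro card_arcs) (auto simp: simple_graph_def)
  finally show ?thesis unfolding edge_intersection_def .
qed

lemma le_min_intersection_iff:
  assumes "finite V"
  shows "k \<le> min_intersection V E \<longleftrightarrow> (\<forall>\<pi>. \<pi> permutes V \<longrightarrow> k \<le> edge_intersection E \<pi>)"
proof -
  have "{edge_intersection E \<pi> | \<pi>. \<pi> permutes V} = edge_intersection E ` {\<pi>. \<pi> permutes V}" by auto
  moreover have "finite {\<pi>. \<pi> permutes V}" using assms by (rule finite_permutations)
  moreover have "{\<pi>. \<pi> permutes V} \<noteq> {}" using permutes_id by blast
  ultimately show ?thesis unfolding min_intersection_def by simp
qed

lemma card_edges_ge:
  assumes G: "simple_graph V E" and n: "10 ^ 20 + 4 \<le> card V" and \<mu>: "5 \<le> min_intersection V E"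
  shows "2 * card V - 2 \<le> card E"
proof (rule ccontr)
  assume "\<not> 2 * card V - 2 \<le> card E"
  then have few: "card E + 3 \<le> 2 * card V" by linarith
  interpret sym_arcs V "arcs E" using G by (rule sym_arcs_arcs)
  have "card (arcs E) = 2 * card E"
    using G finite_simple_graph[OF G] by (intro card_arcs) (auto simp: simple_graph_def)
  then have "card (arcs E) + 6 \<le> 4 * card V" using few by simp
  then obtain \<pi> where \<pi>: "\<pi> permutes V" "card (shared (arcs E) \<pi>) < 10"
    using few_shared_arcs n by blast
  moreover have "5 \<le> edge_intersection E \<pi>" using \<mu> \<pi>(1) le_min_intersection_iff[OF finite_V] by blast
  ultimately show False using card_shared_arcs[OF G \<pi>(1)] by simp
qed

text \<open>
  If \<open>\<pi>\<close> fixes \<open>u\<close>, all spokes are shared. Otherwise let \<open>x = \<pi> u\<close> and \<open>w = \<pi>\<inverse> u\<close>. Any edge at \<open>w\<close> is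
  moved to an edge at \<open>u\<close>, and any edge at \<open>x\<close> is the image of an edge at \<open>u\<close>; both are shared because
  \<open>u\<close> is adjacent to everything. Among these are the edge between \<open>u\<close> and \<open>x\<close>, two more edges at \<open>u\<close>,
  and two at \<open>x\<close> that are not at \<open>u\<close>.
\<close>
lemma hub_forces_five_shared_edges:
  assumes G: "simple_graph V E" and n: "6 \<le> card V" and u: "u \<in> V"
    and spokes: "\<And>v. v \<in> V - {u} \<Longrightarrow> {u, v} \<in> E"
    and rim: "\<And>v. v \<in> V - {u} \<Longrightarrow> \<exists>a\<in>V - {u}. \<exists>b\<in>V - {u}. a \<noteq> b \<and> {v, a} \<in> E \<and> {v, b} \<in> E"
    and \<pi>: "\<pi> permutes V"
  shows "5 \<le> edge_intersection E \<pi>"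
proof -
  let ?F = "E \<inter> permuted_edges \<pi> E"
  have fin: "finite ?F" using finite_simple_graph[OF G] by simp
  have inj: "\<pi> a = \<pi> b \<longleftrightarrow> a = b" for a b using permutes_inj[OF \<pi>] by (simp add: inj_eq)
  have inV: "\<pi> a \<in> V \<longleftrightarrow> a \<in> V" for a using \<pi> by (rule permutes_in_image)
  have moved: "{\<pi> a, \<pi> b} \<in> permuted_edges \<pi> E" if "{a, b} \<in> E" for a b
    using that unfolding permuted_edges_def by blast
  have loopless: "{a, a} \<notin> E" for a using G unfolding simple_graph_def by fastforce
  obtain w where w: "\<pi> w = u" using permutes_surj[OF \<pi>] by (metis surjD)
  show ?thesis
  proof (cases "\<pi> u = u")
    case True
    have "(\<lambda>v. {u, v}) ` (V - {u}) \<subseteq> ?F"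
    proof (rule image_subsetI)
      fix v assume "v \<in> V - {u}"
      then have v: "v \<in> V" "v \<noteq> u" by auto
      obtain v' where v': "\<pi> v' = v" using permutes_surj[OF \<pi>] by (metis surjD)
      then have "v' \<in> V - {u}" using v inV True by auto
      then show "{u, v} \<in> ?F" using spokes v moved[of u v'] True v' by auto
    qed
    then have "card ((\<lambda>v. {u, v}) ` (V - {u})) \<le> card ?F" using fin by (rule card_mono[rotated])
    moreover have "inj_on (\<lambda>v. {u, v}) (V - {u})" by (auto intro!: inj_onI simp: doubleton_eq_iff)
    ultimately show ?thesis
      using n u G unfolding edge_intersection_def simple_graph_def by (simp add: card_image)
  next
    case False
    define x where "x = \<pi> u"
    have x: "x \<in> V - {u}" using False inV u unfolding x_def by auto
    have wV: "w \<in> V - {u}" using w False inV u by auto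
    obtain a b where ab: "a \<in> V - {u}" "b \<in> V - {u}" "a \<noteq> b" "{w, a} \<in> E" "{w, b} \<in> E"
      using rim[OF wV] by blast
    obtain c d where cd: "c \<in> V - {u}" "d \<in> V - {u}" "c \<noteq> d" "{x, c} \<in> E" "{x, d} \<in> E"
      using rim[OF x] by blast
    have spoke_image: "{u, \<pi> v} \<in> ?F" "\<pi> v \<noteq> u" if "{w, v} \<in> E" "v \<in> V" for v
    proof -
      show "\<pi> v \<noteq> u" using that(1) loopless inj[of v w] w by auto
      then show "{u, \<pi> v} \<in> ?F" using spokes[of "\<pi> v"] moved[OF that(1)] inV that(2) w by auto
    qed
    have image_spoke: "{x, v} \<in> ?F" "x \<noteq> v" if "{x, v} \<in> E" "v \<in> V" for v
    proof -
      show "x \<noteq> v" using that(1) loopless by auto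
      obtain v' where v': "\<pi> v' = v" using permutes_surj[OF \<pi>] by (metis surjD)
      have "v' \<in> V - {u}" using v' \<open>x \<noteq> v\<close> inV[of v'] that(2) unfolding x_def by auto
      then show "{x, v} \<in> ?F" using that(1) moved[OF spokes, of v'] v' unfolding x_def by auto
    qed
    have "{w, u} \<in> E" using spokes[OF wV] by (simp add: insert_commute)
    then have "{u, x} \<in> ?F" using spoke_image(1)[of u] u unfolding x_def by simp
    then have "{{u, x}, {u, \<pi> a}, {u, \<pi> b}, {x, c}, {x, d}} \<subseteq> ?F"
      using spoke_image(1) image_spoke(1) ab cd by auto
    then have "card {{u, x}, {u, \<pi> a}, {u, \<pi> b}, {x, c}, {x, d}} \<le> card ?F"
      using fin by (rule card_mono[rotated])
    moreover have "\<pi> a \<noteq> x" "\<pi> b \<noteq> x" "\<pi> a \<noteq> \<pi> b" using ab inj unfolding x_def by auto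
    moreover have "\<pi> a \<noteq> u" "\<pi> b \<noteq> u" "x \<noteq> c" "x \<noteq> d"
      using spoke_image(2) image_spoke(2) ab cd by auto
    ultimately show ?thesis
      using x cd unfolding edge_intersection_def by (auto simp: doubleton_eq_iff card_insert_if)
  qed
qed

text \<open>
  The hub is \<open>m\<close>, and the rim is the cycle through the residues modulo \<open>m\<close>.
\<close>
definition wheel :: "nat \<Rightarrow> nat set set" where
  "wheel m = (\<lambda>i. {m, i}) ` {..<m} \<union> (\<lambda>i. {i, Suc i mod m}) ` {..<m}"

lemma wheel_extremal:
  assumes m: "5 \<le> m"
  shows "simple_graph {..m} (wheel m)" "card (wheel m) \<le> 2 * m" "5 \<le> min_intersection {..m} (wheel m)"
proof -
  have next_ne: "Suc i mod m \<noteq> i" "Suc (Suc i mod m) mod m \<noteq> i" if "i < m" for i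
    using that m by (auto simp: mod_Suc)
  show G: "simple_graph {..m} (wheel m)"
    unfolding simple_graph_def wheel_def using next_ne(1) m
    by (auto simp: card_2_iff less_imp_le)
  have "card (wheel m) \<le> card ((\<lambda>i. {m, i}) ` {..<m}) + card ((\<lambda>i. {i, Suc i mod m}) ` {..<m})"
    unfolding wheel_def by (rule card_Un_le)
  also have "\<dots> \<le> card {..<m} + card {..<m}" by (intro add_mono card_image_le) auto
  finally show "card (wheel m) \<le> 2 * m" by simp
  have "5 \<le> edge_intersection (wheel m) \<pi>" if "\<pi> permutes {..m}" for \<pi>
  proof (rule hub_forces_five_shared_edges[OF G _ _ _ _ that, of m])
    fix v assume "v \<in> {..m} - {m}"
    then have v: "v < m" by auto
    then show "{m, v} \<in> wheel m" unfolding wheel_def by auto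
    define p where "p = (if v = 0 then m - 1 else v - 1)"
    have p: "p < m" "Suc p mod m = v" using v m unfolding p_def by auto
    have "{v, Suc v mod m} \<in> wheel m" "{v, p} \<in> wheel m"
      using v p unfolding wheel_def by (auto simp: insert_commute)
    moreover have "Suc v mod m \<noteq> p" using next_ne(2)[OF p(1)] p(2) by auto
    moreover have "Suc v mod m \<in> {..m} - {m}" "p \<in> {..m} - {m}"
      using p(1) mod_less_divisor[of m "Suc v"] m by (simp_all add: less_imp_le less_imp_neq)
    ultimately show "\<exists>a\<in>{..m} - {m}. \<exists>b\<in>{..m} - {m}. a \<noteq> b \<and> {v, a} \<in> wheel m \<and> {v, b} \<in> wheel m"
      by blast
  qed (use m in auto)
  then show "5 \<le> min_intersection {..m} (wheel m)" by (simp add: le_min_intersection_iff)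
qed

theorem theorem1p2:
  "\<exists>n\<^sub>0::nat. \<forall>n\<ge>n\<^sub>0. min_edges n 5 = 2 * n - 2"
proof (intro exI allI impI)
  fix n :: nat assume n: "10 ^ 20 + 4 \<le> n"
  let ?C = "{card E | (V :: nat set) E. simple_graph V E \<and> card V = n \<and> 5 \<le> min_intersection V E}"
  have m: "5 \<le> n - 1" using n by simp
  have "card {..n - 1} = n" using m by simp
  then have C: "card (wheel (n - 1)) \<in> ?C" using wheel_extremal[OF m] by blast
  then have "min_edges n 5 \<le> card (wheel (n - 1))" unfolding min_edges_def by (intro cInf_lower) auto
  also have "\<dots> \<le> 2 * n - 2" using wheel_extremal(2)[OF m] by simp
  finally have "min_edges n 5 \<le> 2 * n - 2" .
  moreover have "min_edges n 5 \<in> ?C" unfolding min_edges_def using C by (intro Inf_nat_def1) auto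
  then have "2 * n - 2 \<le> min_edges n 5" using card_edges_ge n by auto
  ultimately show "min_edges n 5 = 2 * n - 2" by simp
qed

end
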